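(* Let Assumption $(\mathbf{W^*})$ hold and let $\alpha\in[0,1)$. Then: (i) the functions $v_{n,\alpha}$, $n=1,2,\dots$, and $v_\alpha$ are lower semi-continuous on $\mathbb{X}$, and $v_{n,\alpha}(x)\uparrow v_\alpha(x)$ (monotone nondecreasing convergence) as $n\to+\infty$ for all $x\in\mathbb{X}$; (ii) for $n=0,1,\dots$, $$v_{n+1,\alpha}(x)=\min_{a\in A(x)}\Big\{c(x,a)+\alpha\int_{\mathbb{X}}v_{n,\alpha}(y)q(dy|x,a)\Big\},\qquad x\in\mathbb{X},$$ where $v_{0,\alpha}(x)=0$ for all $x\in\mathbb{X}$, and the sets $$A_{n,\alpha}(x)=\Big\{a\in A(x):\ v_{n+1,\alpha}(x)=c(x,a)+\alpha\int_{\mathbb{X}}v_{n,\alpha}(y)q(dy|x,a)\Big\},\quad x\in\mathbb{X},\ n=0,1,\dots,$$ are nonempty and satisfy: (a) the graph $\mathrm{Gr}(A_{n,\alpha})=\{(x,a):x\in\mathbb{X},a\in A_{n,\alpha}(x)\}$, $n=0,1,\dots$, is a Borel subset of $\mathbb{X}\times\mathbb{A}$; (b) if $v_{n+1,\alpha}(x)=+\infty$, then $A_{n,\alpha}(x)=A(x)$, and if $v_{n+1,\alpha}(x)<+\infty$, then $A_{n,\alpha}(x)$ is compact; (iii) for any $N=1,2,\dots$ there exists a Markov optimal $N$-horizon policy $(\phi_0,\dots,\phi_{N-1})$, and if, for an $N$-horizon Markov policy $(\phi_0,\dots,\phi_{N-1})$, the inclusions $\phi_{N-1-n}(x)\in A_{n,\alpha}(x)$,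 $x\in\mathbb{X}$, $n=0,\dots,N-1$, hold, then this policy is $N$-horizon optimal; (iv) $$v_\alpha(x)=\min_{a\in A(x)}\Big\{c(x,a)+\alpha\int_{\mathbb{X}}v_\alpha(y)q(dy|x,a)\Big\},\qquad x\in\mathbb{X},$$ and the sets $$A_\alpha(x)=\Big\{a\in A(x):\ v_\alpha(x)=c(x,a)+\alpha\int_{\mathbb{X}}v_\alpha(y)q(dy|x,a)\Big\},\quad x\in\mathbb{X},$$ are nonempty and satisfy: (a) the graph $\mathrm{Gr}(A_\alpha)=\{(x,a):x\in\mathbb{X},a\in A_\alpha(x)\}$ is a Borel subset of $\mathbb{X}\times\mathbb{A}$; (b) if $v_\alpha(x)=+\infty$, then $A_\alpha(x)=A(x)$, and if $v_\alpha(x)<+\infty$, then $A_\alpha(x)$ is compact; (v) for the infinite horizon there exists a stationary discount-optimal policy $\phi_\alpha$, and a stationary policy $\phi_\alpha$ is discount-optimal if and only if $\phi_\alpha(x)\in A_\alpha(x)$ for all $x\in\mathbb{X}$; (vi) under Assumption $(\mathbf{Wu})$, the functions $v_{n,\alpha}$, $n=1,2,\dots$, and $v_\alpha$ are inf-compact on $\mathbb{X}$.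
   Context: **MDP.** The state space $\mathbb{X}$ and the action space $\mathbb{A}$ are Borel subsets of Polish spaces. For each $x\in\mathbb{X}$ a nonempty Borel set $A(x)\subseteq\mathbb{A}$ of available actions is given; $\mathrm{Gr}(A)=\{(x,a):x\in\mathbb{X},a\in A(x)\}$ is a Borel subset of $\mathbb{X}\times\mathbb{A}$, and there exists a Borel map $\phi:\mathbb{X}\to\mathbb{A}$ with $\phi(x)\in A(x)$ for all $x$. The one-step cost $c:\mathrm{Gr}(A)\to(-\infty,+\infty]$ is Borel and bounded below. The transition kernel $q$ is such that $q(\cdot|x,a)$ is a Borel probability measure on $\mathbb{X}$ for each $(x,a)$ and $q(B|\cdot,\cdot)$ is Borel on $\mathrm{Gr}(A)$ for each Borel $B\subseteq\mathbb{X}$. **Policies.** A policy $\pi=\{\pi_n\}_{n\ge0}$ is a sequence of regular transition probabilities $\pi_n$ from histories $h_n=(\xi_0,u_0,\dots,u_{n-1},\xi_n)\in(\mathbb{X}\times\mathbb{A})^n\times\mathbb{X}$ to $\mathbb{A}$ with $\pi_n(A(\xi_n)|h_n)=1$; $\Pi$ is the set of all policies. A Markov policy is given by Borel maps $\phi_n:\mathbb{X}\to\mathbb{A}$, $n=0,1,\dots$, with $\phi_n(x)\in A(x)$ for all $x$ (action $\phi_n(\xi_n)$ is used at time $n$); for an $N$-horizon problem only $\phi_0,\dots,\phi_{N-1}$ matter. A stationary policy is a Borel map $\phi:\mathbb{X}\to\mathbb{A}$ with $\phi(x)\in A(x)$ for all $x$ (i.e. $\phi_n=\phi$ for all $n$).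 An initial state $x$ and a policy $\pi$ define a probability $P_x^\pi$ on trajectories $(\xi_0,u_0,\xi_1,u_1,\dots)$ with expectation $\mathbb{E}_x^\pi$. **Costs.** For $\alpha\in[0,1)$: $v_{N,\alpha}^\pi(x)=\mathbb{E}_x^\pi\sum_{n=0}^{N-1}\alpha^n c(\xi_n,u_n)$, $v_{0,\alpha}^\pi=0$, $v_\alpha^\pi(x)=\mathbb{E}_x^\pi\sum_{n=0}^{\infty}\alpha^n c(\xi_n,u_n)$ (with $\alpha^0=1$ and $0\cdot\infty=0$). $v_{N,\alpha}(x)=\inf_{\pi\in\Pi}v_{N,\alpha}^\pi(x)$, $v_\alpha(x)=\inf_{\pi\in\Pi}v_\alpha^\pi(x)$. A policy $\pi$ is $N$-horizon (discount-)optimal if $v_{N,\alpha}^\pi(x)=v_{N,\alpha}(x)$ for all $x\in\mathbb{X}$, and discount-optimal if $v_\alpha^\pi(x)=v_\alpha(x)$ for all $x\in\mathbb{X}$. **Semicontinuity.** An extended-real-valued function $f$ on a set $U$ is lower semi-continuous (resp. inf-compact) on $U$ if for every $\lambda\in\mathbb{R}$ the level set $\{y\in U:f(y)\le\lambda\}$ is closed in $U$ (resp. compact). **Assumption $(\mathbf{W^*})$:** (i) $c$ is lower semi-continuous and bounded below on $\mathrm{Gr}(A)$; (ii) if a sequence $\{x_n\}$ in $\mathbb{X}$ converges to $x\in\mathbb{X}$, then any sequence $\{a_n\}$ with $a_n\in A(x_n)$, such that $\{c(x_n,a_n)\}$ is bounded above, has a limit point (limit of a subsequence) $a\in A(x)$;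 (iii) $q(\cdot|x,a)$ is weakly continuous in $(x,a)\in\mathrm{Gr}(A)$, i.e. $\int f(z)q(dz|x_k,a_k)\to\int f(z)q(dz|x,a)$ for every bounded continuous $f:\mathbb{X}\to\mathbb{R}$ whenever $(x_k,a_k)\to(x,a)$ in $\mathrm{Gr}(A)$. **Assumption $(\mathbf{Wu})$:** (i) $c$ is inf-compact on $\mathrm{Gr}(A)$; (ii) $q(\cdot|x,a)$ is weakly continuous in $(x,a)\in\mathrm{Gr}(A)$.
   Formalization: In (i), monotonicity of v_n is claimed only for c ≥ 0, and for general c for v_n − L(1+…+α^{n−1}) with L any lower bound of c, since it fails for negative costs (one state, c = −1, α = 1/2); the convergence v_n → v is claimed for all c. *)

theory Defs
  imports "HOL-Probability.Probability"
begin

text \<open>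
  The field values are only meaningful on the relevant sets: \<open>avail\<close> on \<open>states\<close>, and
  \<open>cost\<close>, \<open>kernel\<close> on the graph of \<open>avail\<close>.
\<close>

record ('x, 'a) mdp =
  states :: "'x set"
  actions :: "'a set"
  avail :: "'x \<Rightarrow> 'a set"
  cost :: "'x \<times> 'a \<Rightarrow> ereal"
  kernel :: "'x \<times> 'a \<Rightarrow> 'x measure"

abbreviation borel_on :: "'b::topological_space set \<Rightarrow> 'b measure" where
  "borel_on U \<equiv> restrict_space borel U"

definition Gr :: "('x, 'a) mdp \<Rightarrow> ('x \<times> 'a) set" where
  "Gr M = (SIGMA x:states M. avail M x)"

definition selector :: "('x::polish_space, 'a::polish_space) mdp \<Rightarrow> ('x \<Rightarrow> 'a) \<Rightarrow> bool" where
  "selector M \<phi> \<longleftrightarrow> \<phi> \<in> borel_on (states M) \<rightarrow>\<^sub>M borel_on (actions M) \<and>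
     (\<forall>x\<in>states M. \<phi> x \<in> avail M x)"

definition is_mdp :: "('x::polish_space, 'a::polish_space) mdp \<Rightarrow> bool" where
  "is_mdp M \<longleftrightarrow>
     states M \<in> sets borel \<and>
     actions M \<in> sets borel \<and>
     (\<forall>x\<in>states M. avail M x \<noteq> {} \<and> avail M x \<subseteq> actions M \<and> avail M x \<in> sets borel) \<and>
     Gr M \<in> sets borel \<and>
     (\<exists>\<phi>. selector M \<phi>) \<and>
     cost M \<in> borel_measurable (borel_on (Gr M)) \<and>
     (\<exists>L::real. \<forall>z\<in>Gr M. ereal L \<le> cost M z) \<and>
     kernel M \<in> borel_on (Gr M) \<rightarrow>\<^sub>M prob_algebra (borel_on (states M))"


subsection \<open>Policies and the induced probability on trajectories\<close>

abbreviation step_space :: "('x::polish_space, 'a::polish_space) mdp \<Rightarrow> ('x \<times> 'a) measure" where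
  "step_space M \<equiv> borel_on (states M) \<Otimes>\<^sub>M borel_on (actions M)"

text \<open>
  A history \<open>(\<xi>\<^sub>0, u\<^sub>0, \<dots>, u\<^sub>n\<^sub>-\<^sub>1, \<xi>\<^sub>n)\<close> is the pair of the
  sequence \<open>(\<xi>\<^sub>i, u\<^sub>i)\<close>, \<open>i < n\<close>, and the current state \<open>\<xi>\<^sub>n\<close>.
\<close>

abbreviation history_space ::
  "('x::polish_space, 'a::polish_space) mdp \<Rightarrow> nat \<Rightarrow> ((nat \<Rightarrow> 'x \<times> 'a) \<times> 'x) measure" where
  "history_space M n \<equiv> PiM {0..<n} (\<lambda>_. step_space M) \<Otimes>\<^sub>M borel_on (states M)"

type_synonym ('x, 'a) policy = "nat \<Rightarrow> (nat \<Rightarrow> 'x \<times> 'a) \<times> 'x \<Rightarrow> 'a measure"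

definition is_policy :: "('x::polish_space, 'a::polish_space) mdp \<Rightarrow> ('x, 'a) policy \<Rightarrow> bool" where
  "is_policy M \<pi> \<longleftrightarrow>
     (\<forall>n. \<pi> n \<in> history_space M n \<rightarrow>\<^sub>M prob_algebra (borel_on (actions M)) \<and>
          (\<forall>(h, x)\<in>space (history_space M n). emeasure (\<pi> n (h, x)) (avail M x) = 1))"

text \<open>
  Policies are defined on all of \<open>(\<X> \<times> \<A>)\<^sup>n \<times> \<X>\<close>, while \<open>kernel\<close> lives
  on the graph only.  Off the graph we let the state stay put; this choice is immaterial, since
  almost all trajectories of any policy remain in the graph.
\<close>

definition next_state ::
  "('x::polish_space, 'a::polish_space) mdp \<Rightarrow> 'x \<Rightarrow> nat \<Rightarrow> (nat \<Rightarrow> 'x \<times> 'a) \<Rightarrow> 'x measure" where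
  "next_state M x n h =
     (if n = 0 then return (borel_on (states M)) x
      else if h (n - 1) \<in> Gr M then kernel M (h (n - 1))
      else return (borel_on (states M)) (fst (h (n - 1))))"

definition next_step ::
  "('x::polish_space, 'a::polish_space) mdp \<Rightarrow> ('x, 'a) policy \<Rightarrow> 'x \<Rightarrow>
     nat \<Rightarrow> (nat \<Rightarrow> 'x \<times> 'a) \<Rightarrow> ('x \<times> 'a) measure" where
  "next_step M \<pi> x n h =
     next_state M x n h \<bind> (\<lambda>y. \<pi> n (h, y) \<bind> (\<lambda>a. return (step_space M) (y, a)))"

text \<open>\<open>P\<^sub>x\<^sup>\<pi>\<close>, the Ionescu-Tulcea measure of the kernels \<open>next_step\<close>.\<close>

definition traj_measure ::
  "('x::polish_space, 'a::polish_space) mdp \<Rightarrow> ('x, 'a) policy \<Rightarrow> 'x \<Rightarrow> (nat \<Rightarrow> 'x \<times> 'a) measure" where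
  "traj_measure M \<pi> x =
     projective_family.lim UNIV (Ionescu_Tulcea.CI (next_step M \<pi> x) (\<lambda>_. step_space M))
       (\<lambda>_. step_space M)"

definition markov :: "('x::polish_space, 'a::polish_space) mdp \<Rightarrow> (nat \<Rightarrow> 'x \<Rightarrow> 'a) \<Rightarrow> ('x, 'a) policy" where
  "markov M \<phi> = (\<lambda>n (h, x). return (borel_on (actions M)) (\<phi> n x))"

abbreviation stationary :: "('x::polish_space, 'a::polish_space) mdp \<Rightarrow> ('x \<Rightarrow> 'a) \<Rightarrow> ('x, 'a) policy" where
  "stationary M \<phi> \<equiv> markov M (\<lambda>_. \<phi>)"


subsection \<open>Costs\<close>

text \<open>
  Lebesgue integral of an extended-real-valued function, as the difference of the integrals of the
  positive and the negative part (note that \<open>e2ennreal\<close> truncates negative values to \<open>0\<close>).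
  It is only used for integrands that are bounded below almost everywhere under a probability
  measure, so that the subtrahend is finite.
\<close>

definition eintegral :: "'b measure \<Rightarrow> ('b \<Rightarrow> ereal) \<Rightarrow> ereal" where
  "eintegral \<mu> f =
     enn2ereal (\<integral>\<^sup>+z. e2ennreal (f z) \<partial>\<mu>) - enn2ereal (\<integral>\<^sup>+z. e2ennreal (- f z) \<partial>\<mu>)"

definition policy_cost_fin ::
  "('x::polish_space, 'a::polish_space) mdp \<Rightarrow> real \<Rightarrow> nat \<Rightarrow> ('x, 'a) policy \<Rightarrow> 'x \<Rightarrow> ereal" where
  "policy_cost_fin M \<alpha> N \<pi> x =
     eintegral (traj_measure M \<pi> x) (\<lambda>\<omega>. \<Sum>n<N. ereal (\<alpha> ^ n) * cost M (\<omega> n))"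

definition policy_cost ::
  "('x::polish_space, 'a::polish_space) mdp \<Rightarrow> real \<Rightarrow> ('x, 'a) policy \<Rightarrow> 'x \<Rightarrow> ereal" where
  "policy_cost M \<alpha> \<pi> x =
     eintegral (traj_measure M \<pi> x) (\<lambda>\<omega>. \<Sum>n. ereal (\<alpha> ^ n) * cost M (\<omega> n))"

definition value_fin ::
  "('x::polish_space, 'a::polish_space) mdp \<Rightarrow> real \<Rightarrow> nat \<Rightarrow> 'x \<Rightarrow> ereal" where
  "value_fin M \<alpha> N x = (INF \<pi>\<in>{\<pi>. is_policy M \<pi>}. policy_cost_fin M \<alpha> N \<pi> x)"

definition value_inf ::
  "('x::polish_space, 'a::polish_space) mdp \<Rightarrow> real \<Rightarrow> 'x \<Rightarrow> ereal" where
  "value_inf M \<alpha> x = (INF \<pi>\<in>{\<pi>. is_policy M \<pi>}. policy_cost M \<alpha> \<pi> x)"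

definition horizon_optimal ::
  "('x::polish_space, 'a::polish_space) mdp \<Rightarrow> real \<Rightarrow> nat \<Rightarrow> ('x, 'a) policy \<Rightarrow> bool" where
  "horizon_optimal M \<alpha> N \<pi> \<longleftrightarrow>
     is_policy M \<pi> \<and> (\<forall>x\<in>states M. policy_cost_fin M \<alpha> N \<pi> x = value_fin M \<alpha> N x)"

definition discount_optimal ::
  "('x::polish_space, 'a::polish_space) mdp \<Rightarrow> real \<Rightarrow> ('x, 'a) policy \<Rightarrow> bool" where
  "discount_optimal M \<alpha> \<pi> \<longleftrightarrow>
     is_policy M \<pi> \<and> (\<forall>x\<in>states M. policy_cost M \<alpha> \<pi> x = value_inf M \<alpha> x)"

definition bellman ::
  "('x, 'a) mdp \<Rightarrow> real \<Rightarrow> ('x \<Rightarrow> ereal) \<Rightarrow> 'x \<Rightarrow> 'a \<Rightarrow> ereal" where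
  "bellman M \<alpha> v x a = cost M (x, a) + ereal \<alpha> * eintegral (kernel M (x, a)) v"

definition opt_actions_fin ::
  "('x::polish_space, 'a::polish_space) mdp \<Rightarrow> real \<Rightarrow> nat \<Rightarrow> 'x \<Rightarrow> 'a set" where
  "opt_actions_fin M \<alpha> n x =
     {a \<in> avail M x. value_fin M \<alpha> (Suc n) x = bellman M \<alpha> (value_fin M \<alpha> n) x a}"

definition opt_actions ::
  "('x::polish_space, 'a::polish_space) mdp \<Rightarrow> real \<Rightarrow> 'x \<Rightarrow> 'a set" where
  "opt_actions M \<alpha> x =
     {a \<in> avail M x. value_inf M \<alpha> x = bellman M \<alpha> (value_inf M \<alpha>) x a}"

definition is_minimum :: "ereal \<Rightarrow> ereal set \<Rightarrow> bool" where
  "is_minimum m S \<longleftrightarrow> m \<in> S \<and> (\<forall>s\<in>S. m \<le> s)"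


subsection \<open>Semicontinuity and the assumptions\<close>

definition lower_semicont_on :: "'b::topological_space set \<Rightarrow> ('b \<Rightarrow> ereal) \<Rightarrow> bool" where
  "lower_semicont_on U f \<longleftrightarrow>
     (\<forall>r::real. closedin (top_of_set U) {y \<in> U. f y \<le> ereal r})"

definition inf_compact_on :: "'b::topological_space set \<Rightarrow> ('b \<Rightarrow> ereal) \<Rightarrow> bool" where
  "inf_compact_on U f \<longleftrightarrow> (\<forall>r::real. compact {y \<in> U. f y \<le> ereal r})"

definition weakly_continuous_kernel :: "('x::polish_space, 'a::polish_space) mdp \<Rightarrow> bool" where
  "weakly_continuous_kernel M \<longleftrightarrow>
     (\<forall>z z\<^sub>0. (\<forall>k. z k \<in> Gr M) \<and> z\<^sub>0 \<in> Gr M \<and> z \<longlonglongrightarrow> z\<^sub>0 \<longrightarrow>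
        (\<forall>f::'x \<Rightarrow> real. continuous_on (states M) f \<and> bounded (f ` states M) \<longrightarrow>
           (\<lambda>k. \<integral>y. f y \<partial>kernel M (z k)) \<longlonglongrightarrow> (\<integral>y. f y \<partial>kernel M z\<^sub>0)))"

definition assumption_Wstar :: "('x::polish_space, 'a::polish_space) mdp \<Rightarrow> bool" where
  "assumption_Wstar M \<longleftrightarrow>
     (lower_semicont_on (Gr M) (cost M) \<and> (\<exists>L::real. \<forall>z\<in>Gr M. ereal L \<le> cost M z)) \<and>
     (\<forall>x x\<^sub>0 a. (\<forall>n. x n \<in> states M) \<and> x\<^sub>0 \<in> states M \<and> x \<longlonglongrightarrow> x\<^sub>0 \<and>
        (\<forall>n. a n \<in> avail M (x n)) \<and> (\<exists>K::real. \<forall>n. cost M (x n, a n) \<le> ereal K) \<longrightarrow>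
        (\<exists>a\<^sub>0\<in>avail M x\<^sub>0. \<exists>r. strict_mono r \<and> (a \<circ> r) \<longlonglongrightarrow> a\<^sub>0)) \<and>
     weakly_continuous_kernel M"

definition assumption_Wu :: "('x::polish_space, 'a::polish_space) mdp \<Rightarrow> bool" where
  "assumption_Wu M \<longleftrightarrow> inf_compact_on (Gr M) (cost M) \<and> weakly_continuous_kernel M"


subsection \<open>Well-definedness\<close>

lemma is_policy_markov:
  assumes M: "is_mdp M" and \<phi>: "\<And>n. selector M (\<phi> n)"
  shows "is_policy M (markov M \<phi>)"
  unfolding is_policy_def
proof (intro allI conjI)
  fix n
  have [measurable]: "\<phi> n \<in> borel_on (states M) \<rightarrow>\<^sub>M borel_on (actions M)"
    using \<phi>[of n] by (simp add: selector_def)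
  show "markov M \<phi> n \<in> history_space M n \<rightarrow>\<^sub>M prob_algebra (borel_on (actions M))"
    unfolding markov_def by measurable
  show "\<forall>(h, x)\<in>space (history_space M n). emeasure (markov M \<phi> n (h, x)) (avail M x) = 1"
  proof clarify
    fix h x assume "(h, x) \<in> space (history_space M n)"
    then have x: "x \<in> states M" by (auto simp: space_pair_measure space_restrict_space)
    have "avail M x \<in> sets (borel_on (actions M))"
      using M x by (auto simp: is_mdp_def sets_restrict_space_iff)
    then show "emeasure (markov M \<phi> n (h, x)) (avail M x) = 1"
      using \<phi>[of n] x by (simp add: markov_def selector_def)
  qed
qed

lemma sets_step_space:
  assumes M: "is_mdp M"
  shows "sets (step_space M) = sets (borel_on (states M \<times> actions M))"
proof (rule antisym)
  have X: "states M \<in> sets borel" and A: "actions M \<in> sets borel"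
    using M by (simp_all add: is_mdp_def)
  have XA: "states M \<times> actions M \<in> sets borel"
    using pair_measureI[OF X A] by (simp only: borel_prod)
  show "sets (step_space M) \<subseteq> sets (borel_on (states M \<times> actions M))"
  proof (rule sets_pair_in_sets)
    fix B C assume "B \<in> sets (borel_on (states M))" "C \<in> sets (borel_on (actions M))"
    then have BC: "B \<in> sets borel" "B \<subseteq> states M" "C \<in> sets borel" "C \<subseteq> actions M"
      using X A by (auto simp: sets_restrict_space_iff)
    then have "B \<times> C \<in> sets borel"
      using pair_measureI[of B borel C borel] by (simp only: borel_prod)
    then show "B \<times> C \<in> sets (borel_on (states M \<times> actions M))"
      using BC XA by (auto simp: sets_restrict_space_iff)
  qed
  have "(\<lambda>z. (fst z, snd z)) \<in> step_space M \<rightarrow>\<^sub>M borel \<Otimes>\<^sub>M borel"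
    by (intro measurable_Pair measurable_compose[OF measurable_fst]
        measurable_compose[OF measurable_snd] measurable_restrict_space1 measurable_ident_sets[OF refl])
  then have id: "(\<lambda>z. z) \<in> step_space M \<rightarrow>\<^sub>M borel"
    by (simp only: borel_prod prod.collapse)
  show "sets (borel_on (states M \<times> actions M)) \<subseteq> sets (step_space M)"
  proof
    fix D assume "D \<in> sets (borel_on (states M \<times> actions M))"
    then have D: "D \<in> sets borel" "D \<subseteq> states M \<times> actions M"
      using XA by (auto simp: sets_restrict_space_iff)
    have "D \<inter> space (step_space M) \<in> sets (step_space M)"
      using measurable_sets[OF id D(1)] by simp
    moreover have "D \<inter> space (step_space M) = D"
      using D(2) by (auto simp: space_pair_measure space_restrict_space)
    ultimately show "D \<in> sets (step_space M)" by simp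
  qed
qed

lemma measurable_next_state:
  assumes M: "is_mdp M" and x: "x \<in> states M"
  shows "next_state M x n \<in> PiM {0..<n} (\<lambda>_. step_space M) \<rightarrow>\<^sub>M prob_algebra (borel_on (states M))"
proof (cases "n = 0")
  case True
  have "return (borel_on (states M)) x \<in> space (prob_algebra (borel_on (states M)))"
    using x by (simp add: space_prob_algebra prob_space_return space_restrict_space)
  then show ?thesis
    using True by (simp add: next_state_def[abs_def])
next
  case False
  have Gr: "Gr M \<subseteq> states M \<times> actions M" "Gr M \<in> sets borel"
    and k: "kernel M \<in> borel_on (Gr M) \<rightarrow>\<^sub>M prob_algebra (borel_on (states M))"
    using M by (auto simp: is_mdp_def Gr_def)
  have S: "sets (step_space M) = sets (borel_on (states M \<times> actions M))"
    by (rule sets_step_space[OF M])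
  have SA: "states M \<times> actions M \<in> sets borel"
    using pair_measureI[of "states M" borel "actions M" borel] M unfolding is_mdp_def borel_prod by blast
  have "(\<lambda>z. if z \<in> Gr M then kernel M z else return (borel_on (states M)) (fst z))
      \<in> step_space M \<rightarrow>\<^sub>M prob_algebra (borel_on (states M))"
  proof (rule measurable_If_restrict_space_iff[THEN iffD2])
    have G: "Gr M \<in> sets (step_space M)"
      unfolding S using Gr SA by (simp add: sets_restrict_space_iff)
    then show "{z \<in> space (step_space M). z \<in> Gr M} \<in> sets (step_space M)"
      using sets.Int[OF sets.top G] by (simp add: Int_def)
    have "sets (restrict_space (step_space M) {z. z \<in> Gr M}) =
        sets (restrict_space (borel_on (states M \<times> actions M)) (Gr M))"
      unfolding Collect_mem_eq by (rule sets_restrict_space_cong[OF S])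
    also have "\<dots> = sets (borel_on (Gr M))"
      using Gr SA by (simp add: restrict_restrict_space Int_absorb1)
    finally have R: "sets (restrict_space (step_space M) {z. z \<in> Gr M}) = sets (borel_on (Gr M))" .
    have "kernel M \<in> restrict_space (step_space M) {z. z \<in> Gr M} \<rightarrow>\<^sub>M prob_algebra (borel_on (states M))"
      using k unfolding measurable_cong_sets[OF R refl] .
    moreover have "(\<lambda>z. return (borel_on (states M)) (fst z)) \<in> step_space M \<rightarrow>\<^sub>M prob_algebra (borel_on (states M))"
      by (rule measurable_compose[OF measurable_fst measurable_return_prob_space])
    ultimately show "kernel M \<in> restrict_space (step_space M) {z. z \<in> Gr M} \<rightarrow>\<^sub>M prob_algebra (borel_on (states M)) \<and>
      (\<lambda>z. return (borel_on (states M)) (fst z)) \<in> restrict_space (step_space M) {z. z \<notin> Gr M}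
        \<rightarrow>\<^sub>M prob_algebra (borel_on (states M))"
      by (blast intro: measurable_restrict_space1)
  qed
  note [measurable] = this
  have "(\<lambda>h. (\<lambda>z. if z \<in> Gr M then kernel M z else return (borel_on (states M)) (fst z)) (h (n - 1)))
      \<in> PiM {0..<n} (\<lambda>_. step_space M) \<rightarrow>\<^sub>M prob_algebra (borel_on (states M))"
    using False by (intro measurable_compose[OF measurable_component_singleton]) auto
  then show ?thesis
    using False by (simp add: next_state_def[abs_def])
qed

lemma measurable_next_step:
  assumes M: "is_mdp M" and \<pi>: "is_policy M \<pi>" and x: "x \<in> states M"
  shows "next_step M \<pi> x n \<in> PiM {0..<n} (\<lambda>_. step_space M) \<rightarrow>\<^sub>M prob_algebra (step_space M)"
proof -
  note [measurable] = measurable_next_state[OF M x, of n]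
  have [measurable]: "\<pi> n \<in> history_space M n \<rightarrow>\<^sub>M prob_algebra (borel_on (actions M))"
    using \<pi> by (simp add: is_policy_def)
  show ?thesis
    unfolding next_step_def[abs_def] by measurable
qed

text \<open>Hence the trajectory measure is a genuine Ionescu-Tulcea limit.\<close>

lemma Ionescu_Tulcea_next_step:
  assumes M: "is_mdp M" and \<pi>: "is_policy M \<pi>" and x: "x \<in> states M"
  shows "Ionescu_Tulcea (next_step M \<pi> x) (\<lambda>_. step_space M)"
proof (rule Ionescu_Tulcea.intro)
  note * = measurable_next_step[OF assms]
  show "next_step M \<pi> x i \<in> PiM {0..<i} (\<lambda>_. step_space M) \<rightarrow>\<^sub>M subprob_algebra (step_space M)" for i
    by (rule measurable_prob_algebraD[OF *])
  show "prob_space (next_step M \<pi> x i h)" if "h \<in> space (PiM {0..<i} (\<lambda>_. step_space M))" for i h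
    using measurable_space[OF * that] by (simp add: space_prob_algebra)
qed

lemma distr_traj_measure:
  assumes M: "is_mdp M" and \<pi>: "is_policy M \<pi>" and x: "x \<in> states M" and J: "finite J"
  shows "distr (traj_measure M \<pi> x) (PiM J (\<lambda>_. step_space M)) (\<lambda>\<omega>. restrict \<omega> J) =
    Ionescu_Tulcea.CI (next_step M \<pi> x) (\<lambda>_. step_space M) J"
proof -
  interpret Ionescu_Tulcea "next_step M \<pi> x" "\<lambda>_. step_space M"
    by (rule Ionescu_Tulcea_next_step[OF M \<pi> x])
  show ?thesis
    unfolding traj_measure_def by (rule distr_lim[OF J])
qed

end

theory Submission
  imports Defs
begin

text \<open>
  If the cost is bounded below by \<open>L\<close>, then replacing \<open>c\<close> by \<open>c - L\<close> changes every
  \<open>n\<close>-horizon cost by the same finite number \<open>L (1 + \<alpha> + \<dots> + \<alpha>\<^sup>n\<^sup>-\<^sup>1)\<close> and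
  every infinite-horizon cost by \<open>L / (1 - \<alpha>)\<close>.  All the work is therefore done with
  nonnegative costs and integrals in \<^typ>\<open>ennreal\<close>, and the results are shifted back at
  the end.

  The core is the Bellman operator \<open>w \<mapsto> (\<lambda>x. INF a. c(x,a) + \<alpha> \<integral> w dq(x,a))\<close> on nonnegative
  lower semicontinuous functions.  Such a \<open>w\<close> is an increasing limit of bounded Lipschitz
  functions, so weak continuity of \<open>q\<close> makes \<open>\<integral> w dq(x,a)\<close> lower semicontinuous in
  \<open>(x,a)\<close> (\<open>seq_lsc_nn_integral\<close>).  The compactness part of assumption \<open>W*\<close> says that actions of
  bounded cost along a convergent sequence of states accumulate at an available action, and this
  property is inherited by every function above the cost.  It follows that the infimum over actions
  is attained, that it is lower semicontinuous in the state even when only actions in a fixed closed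
  set are allowed (\<open>seq_lsc_min_on\<close>), and that the sets of minimizers are compact where the
  minimum is finite.

  The closed sets give measurable selection: where the minimum is finite, the set of minimizers meets
  a closed set \<open>F\<close> exactly if the minimum over \<open>F\<close> equals the full minimum, which is a Borel
  condition because both minima are lower semicontinuous functions of the state.  A compact-valued map with this property has a Borel
  selector (\<open>compact_valued_selection\<close>).

  Starting from \<open>0\<close>, value iteration increases to a limit, and the limit solves the optimality
  equation: an accumulation point of the \<open>n\<close>-step minimizers at \<open>x\<close> is a minimizer for the limit
  (\<open>bellman_value_lim\<close>).  To compare with policies, one integrates the one-step inequality
  \<open>w\<^sub>n(\<xi>\<^sub>n) \<le> c(\<xi>\<^sub>n,u\<^sub>n) + \<alpha> \<integral> w\<^sub>n\<^sub>+\<^sub>1 dq(\<xi>\<^sub>n,u\<^sub>n)\<close> along the trajectory and telescopes.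
  For value iteration this bounds the cost of every policy from below, and the inequality becomes an
  equality for policies that use minimizers (\<open>telescope_le\<close>, \<open>telescope_markov\<close>).  Hence value
  iteration is the finite-horizon value, and its limit is the infinite-horizon value: it bounds all
  policies from below, and the stationary policy of minimizers attains it since its partial costs
  never exceed it.  Conversely the cost of a stationary policy solves the fixed-point equation of that
  policy, so a discount-optimal one must choose minimizers.
\<close>

section \<open>Sequential lower semicontinuity\<close>

text \<open>
  The sequential form fits assumption \<open>W*\<close>, which speaks of sequences of states and actions; on
  subsets of metric spaces it is equivalent to closedness of the level sets.
\<close>

definition seq_lsc :: "'b::topological_space set \<Rightarrow> ('b \<Rightarrow> ennreal) \<Rightarrow> bool" where
  "seq_lsc S f \<longleftrightarrow>
     (\<forall>z l. (\<forall>k. z k \<in> S) \<longrightarrow> l \<in> S \<longrightarrow> z \<longlonglongrightarrow> l \<longrightarrow> f l \<le> liminf (\<lambda>k. f (z k)))"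

lemma seq_lscD:
  "seq_lsc S f \<Longrightarrow> (\<And>k. z k \<in> S) \<Longrightarrow> l \<in> S \<Longrightarrow> z \<longlonglongrightarrow> l \<Longrightarrow> f l \<le> liminf (\<lambda>k. f (z k))"
  unfolding seq_lsc_def by blast

lemma seq_lsc_level:
  assumes "seq_lsc S f" "\<And>k. z k \<in> S" "l \<in> S" "z \<longlonglongrightarrow> l" "\<And>k. f (z k) \<le> t"
  shows "f l \<le> t"
proof -
  have "f l \<le> liminf (\<lambda>k. f (z k))"
    by (rule seq_lscD) fact+
  also have "\<dots> \<le> liminf (\<lambda>k. t)"
    by (intro Liminf_mono always_eventually) (simp add: assms)
  finally show ?thesis
    by (simp add: Liminf_const)
qed

text \<open>
  Closedness of the level sets suffices: if the lower limit fell below the value at the limit point,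
  a subsequence would stay in a level set that does not contain that point.
\<close>

lemma seq_lscI_level:
  assumes *: "\<And>z l t. (\<And>k. z k \<in> S) \<Longrightarrow> l \<in> S \<Longrightarrow> z \<longlonglongrightarrow> l \<Longrightarrow> t < top \<Longrightarrow> (\<And>k. f (z k) \<le> t) \<Longrightarrow> f l \<le> t"
  shows "seq_lsc S f"
  unfolding seq_lsc_def
proof (intro allI impI, rule ccontr)
  fix z l assume z: "\<forall>k. z k \<in> S" "l \<in> S" "z \<longlonglongrightarrow> l" and "\<not> f l \<le> liminf (\<lambda>k. f (z k))"
  then obtain t where t: "liminf (\<lambda>k. f (z k)) < t" "t < f l"
    using dense by (metis not_le)
  then have "\<not> t \<le> liminf (\<lambda>k. f (z k))"
    by simp
  then obtain y where y: "y < t" "\<exists>\<^sub>F k in sequentially. f (z k) \<le> y"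
    unfolding le_Liminf_iff by (auto simp: not_eventually not_less)
  then have "infinite {k. f (z k) \<le> y}"
    by (simp add: frequently_cofinite flip: cofinite_eq_sequentially)
  then obtain r :: "nat \<Rightarrow> nat" where r: "strict_mono r" "\<And>n. r n \<in> {k. f (z k) \<le> y}"
    using infinite_enumerate by blast
  have "f l \<le> y"
  proof (rule *[of "z \<circ> r" l y])
    show "(z \<circ> r) \<longlonglongrightarrow> l"
      using z(3) r(1) by (rule LIMSEQ_subseq_LIMSEQ)
    show "y < top"
      using y(1) by (rule less_le_trans) simp
  qed (use z r in auto)
  with y t show False
    by auto
qed

lemma Liminf_add_ennreal:
  fixes f g :: "nat \<Rightarrow> ennreal"
  shows "liminf f + liminf g \<le> liminf (\<lambda>n. f n + g n)"
proof -
  have "liminf f + liminf g = (SUP n. (INF m\<in>{n..}. f m) + (INF m\<in>{n..}. g m))"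
    unfolding liminf_SUP_INF
    by (rule ennreal_SUP_add[symmetric]) (auto simp: incseq_def intro!: INF_superset_mono)
  also have "\<dots> \<le> (SUP n. INF m\<in>{n..}. f m + g m)"
    by (intro SUP_mono' INF_greatest add_mono INF_lower)
  finally show ?thesis
    unfolding liminf_SUP_INF .
qed

lemma Liminf_cmult_ennreal:
  fixes f :: "nat \<Rightarrow> ennreal"
  shows "c * liminf f \<le> liminf (\<lambda>n. c * f n)"
  unfolding liminf_SUP_INF SUP_mult_left_ennreal
  by (intro SUP_mono' INF_greatest mult_left_mono INF_lower) auto

lemma seq_lsc_add:
  assumes "seq_lsc S f" "seq_lsc S g" shows "seq_lsc S (\<lambda>x. f x + g x)"
  unfolding seq_lsc_def
proof (intro allI impI)
  fix z l assume "\<forall>k. z k \<in> S" "l \<in> S" "z \<longlonglongrightarrow> l"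
  then have "f l + g l \<le> liminf (\<lambda>k. f (z k)) + liminf (\<lambda>k. g (z k))"
    by (intro add_mono seq_lscD[OF assms(1)] seq_lscD[OF assms(2)]) auto
  also note Liminf_add_ennreal
  finally show "f l + g l \<le> liminf (\<lambda>k. f (z k) + g (z k))" .
qed

lemma seq_lsc_cmult:
  assumes "seq_lsc S f" shows "seq_lsc S (\<lambda>x. c * f x)"
  unfolding seq_lsc_def
proof (intro allI impI)
  fix z l assume "\<forall>k. z k \<in> S" "l \<in> S" "z \<longlonglongrightarrow> l"
  then have "c * f l \<le> c * liminf (\<lambda>k. f (z k))"
    by (intro mult_left_mono seq_lscD[OF assms(1)]) auto
  also note Liminf_cmult_ennreal
  finally show "c * f l \<le> liminf (\<lambda>k. c * f (z k))" .
qed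

lemma seq_lsc_SUP:
  assumes "\<And>i. i \<in> I \<Longrightarrow> seq_lsc S (f i)" shows "seq_lsc S (\<lambda>x. SUP i\<in>I. f i x)"
proof (rule seq_lscI_level)
  fix z l t assume z: "\<And>k. z k \<in> S" "l \<in> S" "z \<longlonglongrightarrow> l" and t: "\<And>k. (SUP i\<in>I. f i (z k)) \<le> t"
  show "(SUP i\<in>I. f i l) \<le> t"
    by (rule SUP_least, rule seq_lsc_level[OF assms z]) (use t in \<open>auto simp: SUP_le_iff\<close>)
qed

lemma seq_lsc_cong:
  assumes "\<And>x. x \<in> S \<Longrightarrow> f x = g x" shows "seq_lsc S f \<longleftrightarrow> seq_lsc S g"
  unfolding seq_lsc_def using assms by auto

lemma seq_lsc_nhd:
  fixes S :: "'b::metric_space set"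
  assumes f: "seq_lsc S f" and x: "x \<in> S" and t: "t < f x"
  shows "\<exists>\<delta>>0. \<forall>y\<in>S. dist x y < \<delta> \<longrightarrow> t < f y"
proof (rule ccontr)
  assume "\<not> ?thesis"
  then have "\<exists>y. y \<in> S \<and> dist x y < inverse (real (Suc n)) \<and> f y \<le> t" for n
    by (metis inverse_positive_iff_positive not_le of_nat_0_less_iff zero_less_Suc)
  then obtain y where y: "\<And>n. y n \<in> S" "\<And>n. dist x (y n) < inverse (real (Suc n))" "\<And>n. f (y n) \<le> t"
    by metis
  have "(\<lambda>n. dist (y n) x) \<longlonglongrightarrow> 0"
    by (rule tendsto_sandwich[OF _ _ tendsto_const LIMSEQ_inverse_real_of_nat])
       (use y(2) in \<open>auto simp: dist_commute intro!: always_eventually less_imp_le\<close>)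
  then have "y \<longlonglongrightarrow> x"
    by (subst tendsto_dist_iff)
  from seq_lsc_level[OF f y(1) x this y(3)] t show False
    by simp
qed

text \<open>
  The largest \<open>k\<close>-Lipschitz function below \<open>min f k\<close> (its Pasch-Hausdorff envelope); it turns a lower semicontinuous function into an increasing limit of functions against
  which weak continuity can be applied.
\<close>

definition lipschitz_reg :: "'b::metric_space set \<Rightarrow> ('b \<Rightarrow> ennreal) \<Rightarrow> nat \<Rightarrow> 'b \<Rightarrow> ennreal" where
  "lipschitz_reg S f k x = (INF y\<in>S. min (f y) (of_nat k) + of_nat k * ennreal (dist x y))"

lemma lipschitz_reg_le:
  assumes "x \<in> S" shows "lipschitz_reg S f k x \<le> min (f x) (of_nat k)"
  unfolding lipschitz_reg_def by (rule INF_lower2[OF assms]) simp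

lemma lipschitz_reg_mono: "k \<le> m \<Longrightarrow> lipschitz_reg S f k x \<le> lipschitz_reg S f m x"
  unfolding lipschitz_reg_def
  by (intro INF_mono' add_mono min.mono mult_right_mono) auto

lemma INF_const_add_ennreal:
  fixes f :: "'i \<Rightarrow> ennreal"
  assumes "I \<noteq> {}" shows "(INF i\<in>I. c + f i) = c + (INF i\<in>I. f i)"
  using continuous_at_Inf_mono[of "\<lambda>x. c + x" "f ` I"] assms
    continuous_add[of "at_right (Inf (f ` I))", of "\<lambda>x. c" "\<lambda>x. x"]
  by (auto simp: mono_def image_comp)

lemma lipschitz_reg_lipschitz:
  assumes "S \<noteq> {}"
  shows "lipschitz_reg S f k x \<le> of_nat k * ennreal (dist x x') + lipschitz_reg S f k x'"
proof -
  have "lipschitz_reg S f k x \<le>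
      (INF y\<in>S. of_nat k * ennreal (dist x x') + (min (f y) (of_nat k) + of_nat k * ennreal (dist x' y)))"
    unfolding lipschitz_reg_def
  proof (rule INF_mono')
    fix y
    have "ennreal (dist x y) \<le> ennreal (dist x x') + ennreal (dist x' y)"
      by (simp add: dist_triangle flip: ennreal_plus)
    from mult_left_mono[OF this, of "of_nat k"]
    have "min (f y) (of_nat k) + of_nat k * ennreal (dist x y) \<le>
      min (f y) (of_nat k) + (of_nat k * ennreal (dist x x') + of_nat k * ennreal (dist x' y))"
      by (intro add_left_mono) (simp add: distrib_left)
    then show "min (f y) (of_nat k) + of_nat k * ennreal (dist x y) \<le>
      of_nat k * ennreal (dist x x') + (min (f y) (of_nat k) + of_nat k * ennreal (dist x' y))"
      by (simp add: ac_simps)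
  qed
  also have "\<dots> = of_nat k * ennreal (dist x x') + lipschitz_reg S f k x'"
    unfolding lipschitz_reg_def
    by (rule INF_const_add_ennreal[OF assms])
  finally show ?thesis .
qed

lemma lipschitz_reg_finite: "x \<in> S \<Longrightarrow> lipschitz_reg S f k x < top"
  by (rule le_less_trans[OF lipschitz_reg_le]) (auto simp: min_less_iff_disj of_nat_less_top)

lemma continuous_on_lipschitz_reg: "continuous_on S (\<lambda>x. enn2real (lipschitz_reg S f k x))"
proof -
  have *: "enn2real (lipschitz_reg S f k x) \<le> real k * dist x x' + enn2real (lipschitz_reg S f k x')"
    if "x \<in> S" "x' \<in> S" for x x'
  proof -
    have "enn2real (lipschitz_reg S f k x) \<le>
        enn2real (of_nat k * ennreal (dist x x') + lipschitz_reg S f k x')"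
      by (rule enn2real_mono[OF lipschitz_reg_lipschitz])
         (use lipschitz_reg_finite[OF that(2)] that in \<open>auto simp: ennreal_mult_less_top of_nat_less_top\<close>)
    also have "\<dots> = real k * dist x x' + enn2real (lipschitz_reg S f k x')"
      by (subst enn2real_plus)
         (use lipschitz_reg_finite[OF that(2)] in \<open>auto simp: ennreal_mult_less_top of_nat_less_top enn2real_mult\<close>)
    finally show ?thesis .
  qed
  have "(real k)-lipschitz_on S (\<lambda>x. enn2real (lipschitz_reg S f k x))"
  proof (rule lipschitz_onI)
    fix x y assume "x \<in> S" "y \<in> S"
    from *[OF this] *[OF this(2,1)]
    show "dist (enn2real (lipschitz_reg S f k x)) (enn2real (lipschitz_reg S f k y)) \<le> real k * dist x y"
      by (auto simp: dist_real_def dist_commute abs_le_iff)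
  qed simp
  then show ?thesis
    by (rule lipschitz_on_continuous_on)
qed

text \<open>
  If \<open>t < f x\<close>, then \<open>f > t\<close> on some ball around \<open>x\<close>; outside the ball the penalty
  \<open>k * dist x y\<close> exceeds \<open>t\<close> as soon as \<open>k\<close> is large.
\<close>

lemma SUP_lipschitz_reg:
  assumes f: "seq_lsc S f" and x: "x \<in> S"
  shows "(SUP k. lipschitz_reg S f k x) = f x"
proof (rule antisym)
  show "(SUP k. lipschitz_reg S f k x) \<le> f x"
    using lipschitz_reg_le[OF x] by (intro SUP_least) auto
  show "f x \<le> (SUP k. lipschitz_reg S f k x)"
  proof (rule dense_le)
    fix t assume t: "t < f x"
    then obtain r where r: "t = ennreal r" "0 \<le> r"
      using top.not_eq_extremum by (cases t) auto
    obtain \<delta> where \<delta>: "\<delta> > 0" "\<And>y. y \<in> S \<Longrightarrow> dist x y < \<delta> \<Longrightarrow> t < f y"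
      using seq_lsc_nhd[OF f x t] by auto
    obtain k :: nat where k: "max r (r / \<delta>) < real k"
      using reals_Archimedean2 by blast
    have "t \<le> lipschitz_reg S f k x"
      unfolding lipschitz_reg_def
    proof (rule INF_greatest)
      fix y assume y: "y \<in> S"
      show "t \<le> min (f y) (of_nat k) + of_nat k * ennreal (dist x y)"
      proof (cases "dist x y < \<delta>")
        case True
        then have "t \<le> min (f y) (of_nat k)"
          using \<delta>(2)[OF y] k r by (auto simp: ennreal_of_nat_eq_real_of_nat intro: less_imp_le ennreal_leI)
        then show ?thesis
          by (rule order_trans) simp
      next
        case False
        have "r \<le> real k * \<delta>"
          using k \<delta>(1) by (auto simp: field_simps)
        also have "\<dots> \<le> real k * dist x y"
          using False by (intro mult_left_mono) auto
        finally have "t \<le> of_nat k * ennreal (dist x y)"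
          by (simp add: r ennreal_of_nat_eq_real_of_nat ennreal_leI flip: ennreal_mult)
        then show ?thesis
          by (rule order_trans) simp
      qed
    qed
    also have "\<dots> \<le> (SUP k. lipschitz_reg S f k x)"
      by (rule SUP_upper) simp
    finally show "t \<le> (SUP k. lipschitz_reg S f k x)" .
  qed
qed

lemma measurable_lipschitz_reg: "lipschitz_reg S f k \<in> borel_measurable (borel_on S)"
proof -
  have "(\<lambda>x. ennreal (enn2real (lipschitz_reg S f k x))) \<in> borel_measurable (borel_on S)"
    by (intro measurable_compose[OF _ measurable_ennreal]
        borel_measurable_continuous_on_restrict continuous_on_lipschitz_reg)
  then show ?thesis
    by (rule measurable_cong[THEN iffD1, rotated]) (simp add: space_restrict_space lipschitz_reg_finite)
qed

lemma borel_measurable_seq_lsc: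
  fixes S :: "'b::metric_space set"
  assumes f: "seq_lsc S f" shows "f \<in> borel_measurable (borel_on S)"
proof -
  have "(\<lambda>x. SUP k. lipschitz_reg S f k x) \<in> borel_measurable (borel_on S)"
    by (intro borel_measurable_SUP countableI_type measurable_lipschitz_reg)
  then show ?thesis
    by (rule measurable_cong[THEN iffD1, rotated]) (simp add: space_restrict_space SUP_lipschitz_reg[OF f])
qed

text \<open>
  One half of the portmanteau theorem for kernels: the integrals of the Lipschitz regularizations
  are continuous, and by monotone convergence the integral of \<open>f\<close> is their supremum.
\<close>

lemma seq_lsc_nn_integral:
  fixes S :: "'b::metric_space set" and K :: "'c::topological_space \<Rightarrow> 'b measure"
  assumes f: "seq_lsc S f"
    and K: "\<And>z. z \<in> G \<Longrightarrow> prob_space (K z)" "\<And>z. z \<in> G \<Longrightarrow> sets (K z) = sets (borel_on S)"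
    and weak: "\<And>z z\<^sub>0 (g :: 'b \<Rightarrow> real). (\<And>k. z k \<in> G) \<Longrightarrow> z\<^sub>0 \<in> G \<Longrightarrow> z \<longlonglongrightarrow> z\<^sub>0 \<Longrightarrow>
      continuous_on S g \<Longrightarrow> bounded (g ` S) \<Longrightarrow>
      (\<lambda>k. \<integral>y. g y \<partial>K (z k)) \<longlonglongrightarrow> (\<integral>y. g y \<partial>K z\<^sub>0)"
  shows "seq_lsc G (\<lambda>z. \<integral>\<^sup>+y. f y \<partial>K z)"
proof -
  let ?r = "lipschitz_reg S f"
  have space_K: "space (K z) = S" if "z \<in> G" for z
    using sets_eq_imp_space_eq[OF K(2)[OF that]] by (simp add: space_restrict_space)
  have bounded: "enn2real (?r k y) \<le> real k" if "y \<in> S" for k y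
    using lipschitz_reg_le[OF that, of f k]
    by (intro enn2real_leI) (auto simp: ennreal_of_nat_eq_real_of_nat)
  have r_int: "(\<integral>\<^sup>+y. ?r k y \<partial>K z) = ennreal (\<integral>y. enn2real (?r k y) \<partial>K z)" if z: "z \<in> G" for k z
  proof -
    interpret prob_space "K z" by (rule K(1)[OF z])
    have "(\<integral>\<^sup>+y. ?r k y \<partial>K z) = (\<integral>\<^sup>+y. ennreal (enn2real (?r k y)) \<partial>K z)"
      by (rule nn_integral_cong) (simp add: space_K[OF z] lipschitz_reg_finite)
    also have "\<dots> = ennreal (\<integral>y. enn2real (?r k y) \<partial>K z)"
    proof (rule nn_integral_eq_integral)
      show "integrable (K z) (\<lambda>y. enn2real (?r k y))"
      proof (rule integrable_const_bound[where B="real k"])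
        show "AE y in K z. norm (enn2real (?r k y)) \<le> real k"
          using bounded by (intro AE_I2) (simp add: space_K[OF z])
        show "(\<lambda>y. enn2real (?r k y)) \<in> borel_measurable (K z)"
          unfolding measurable_cong_sets[OF K(2)[OF z] refl]
          by (intro borel_measurable_continuous_on_restrict continuous_on_lipschitz_reg)
      qed
    qed simp
    finally show ?thesis .
  qed
  have "seq_lsc G (\<lambda>z. \<integral>\<^sup>+y. ?r k y \<partial>K z)" for k
    unfolding seq_lsc_def
  proof (intro allI impI)
    fix z l assume z: "\<forall>k. z k \<in> G" "l \<in> G" "z \<longlonglongrightarrow> l"
    have "bounded ((\<lambda>y. enn2real (?r k y)) ` S)"
      by (rule boundedI[where B="real k"]) (use bounded in auto)
    with z have "(\<lambda>n. \<integral>y. enn2real (?r k y) \<partial>K (z n)) \<longlonglongrightarrow> (\<integral>y. enn2real (?r k y) \<partial>K l)"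
      by (intro weak continuous_on_lipschitz_reg) auto
    then have "(\<lambda>n. \<integral>\<^sup>+y. ?r k y \<partial>K (z n)) \<longlonglongrightarrow> (\<integral>\<^sup>+y. ?r k y \<partial>K l)"
      using z by (simp add: r_int)
    then show "(\<integral>\<^sup>+y. ?r k y \<partial>K l) \<le> liminf (\<lambda>n. \<integral>\<^sup>+y. ?r k y \<partial>K (z n))"
      by (simp add: lim_imp_Liminf)
  qed
  then have "seq_lsc G (\<lambda>z. SUP k. \<integral>\<^sup>+y. ?r k y \<partial>K z)"
    by (rule seq_lsc_SUP)
  moreover have "(SUP k. \<integral>\<^sup>+y. ?r k y \<partial>K z) = (\<integral>\<^sup>+y. f y \<partial>K z)" if z: "z \<in> G" for z
  proof -
    have "(SUP k. \<integral>\<^sup>+y. ?r k y \<partial>K z) = (\<integral>\<^sup>+y. (SUP k. ?r k y) \<partial>K z)"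
    proof (rule nn_integral_monotone_convergence_SUP[symmetric])
      show "incseq ?r"
        by (auto simp: incseq_def le_fun_def lipschitz_reg_mono)
      show "?r k \<in> borel_measurable (K z)" for k
        unfolding measurable_cong_sets[OF K(2)[OF z] refl] by (rule measurable_lipschitz_reg)
    qed
    also have "\<dots> = (\<integral>\<^sup>+y. f y \<partial>K z)"
      by (rule nn_integral_cong) (simp add: space_K[OF z] SUP_lipschitz_reg[OF f])
    finally show ?thesis .
  qed
  ultimately show ?thesis
    by (simp cong: seq_lsc_cong)
qed

section \<open>Measurable selection from compact-valued maps\<close>

text \<open>
  A list of indices into a dense sequence \<open>d\<close>, read from its end, names an intersection of balls
  with radii \<open>1, 1/2, 1/4, \<dots>\<close>.  The address of a set \<open>K\<close> to depth \<open>k\<close> is found greedily: at each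
  depth take the first ball for which the intersection still meets \<open>K\<close>.
\<close>

primrec cell :: "(nat \<Rightarrow> 'a::metric_space) \<Rightarrow> nat list \<Rightarrow> 'a set" where
  "cell d [] = UNIV"
| "cell d (i # l) = cell d l \<inter> cball (d i) ((1/2) ^ length l)"

primrec address :: "(nat \<Rightarrow> 'a::metric_space) \<Rightarrow> 'a set \<Rightarrow> nat \<Rightarrow> nat list" where
  "address d K 0 = []"
| "address d K (Suc k) = (LEAST i. K \<inter> cell d (i # address d K k) \<noteq> {}) # address d K k"

lemma closed_cell: "closed (cell d l)"
  by (induction l) auto

lemma length_address [simp]: "length (address d K k) = k"
  by (induction k) auto

lemma cell_address_decreasing: "m \<le> n \<Longrightarrow> cell d (address d K n) \<subseteq> cell d (address d K m)"
  by (rule lift_Suc_antimono_le[of "\<lambda>n. cell d (address d K n)"]) auto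

lemma address_step:
  assumes d: "\<And>y e. 0 < e \<Longrightarrow> \<exists>i. dist (d i) y < e" and ne: "K \<inter> cell d l \<noteq> {}"
  shows "\<exists>i. K \<inter> cell d (i # l) \<noteq> {}"
proof -
  obtain y where y: "y \<in> K" "y \<in> cell d l"
    using ne by auto
  obtain i where "dist (d i) y < (1/2) ^ length l"
    using d[of "(1/2) ^ length l" y] by auto
  with y have "y \<in> K \<inter> cell d (i # l)"
    by auto
  then show ?thesis by blast
qed

lemma cell_address_meets:
  assumes d: "\<And>y e. 0 < e \<Longrightarrow> \<exists>i. dist (d i) y < e" and K: "K \<noteq> {}"
  shows "K \<inter> cell d (address d K k) \<noteq> {}"
proof (induction k)
  case (Suc k)
  show ?case
    using LeastI_ex[OF address_step[OF d Suc]] by simp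
qed (use K in simp)

text \<open>
  A compact-valued case of the Kuratowski--Ryll-Nardzewski theorem.  Whether the address of
  \<open>\<Psi> x\<close> to a given depth is a given list depends on finitely many questions of the form "does \<open>\<Psi> x\<close> meet this
  closed set", so the centres of the chosen balls depend measurably on \<open>x\<close>.  They converge to a
  point of \<open>\<Psi> x\<close> that compactness provides in the intersection of all the cells.
\<close>

lemma compact_valued_selection:
  fixes \<Psi> :: "'b \<Rightarrow> 'a::polish_space set"
  assumes compact: "\<And>x. x \<in> space N \<Longrightarrow> compact (\<Psi> x)"
    and ne: "\<And>x. x \<in> space N \<Longrightarrow> \<Psi> x \<noteq> {}"
    and hits: "\<And>F. closed F \<Longrightarrow> {x \<in> space N. \<Psi> x \<inter> F \<noteq> {}} \<in> sets N"
  shows "\<exists>\<phi>\<in>N \<rightarrow>\<^sub>M borel. \<forall>x\<in>space N. \<phi> x \<in> \<Psi> x"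
proof -
  obtain D :: "'a set" where D: "countable D" "\<And>X. open X \<Longrightarrow> X \<noteq> {} \<Longrightarrow> \<exists>d\<in>D. d \<in> X"
    using countable_dense_exists by blast
  define d where "d = from_nat_into D"
  have d: "\<exists>i. dist (d i) y < e" if e: "0 < e" for y e
  proof -
    have "ball y e \<noteq> {}"
      using e by simp
    obtain z where z: "z \<in> D" "z \<in> ball y e"
      using D(2)[OF open_ball \<open>ball y e \<noteq> {}\<close>] by blast
    have "d (to_nat_on D z) = z"
      unfolding d_def using D(1) z(1) by simp
    with z(2) show ?thesis
      by (intro exI[of _ "to_nat_on D z"]) (simp add: dist_commute)
  qed
  let ?addr = "\<lambda>k x. address d (\<Psi> x) k"
  have ex: "\<exists>i. \<Psi> x \<inter> cell d (i # ?addr k x) \<noteq> {}" if "x \<in> space N" for x k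
    by (rule address_step[OF d cell_address_meets[OF d ne[OF that]]])

  have addr_sets: "{x \<in> space N. ?addr k x = l} \<in> sets N" for k l
  proof (induction k arbitrary: l)
    case 0
    then show ?case by (cases l) auto
  next
    case (Suc k)
    show ?case
    proof (cases l)
      case (Cons i l')
      have "{x \<in> space N. ?addr (Suc k) x = l} =
        {x \<in> space N. ?addr k x = l'} \<inter> {x \<in> space N. \<Psi> x \<inter> cell d (i # l') \<noteq> {}} -
        (\<Union>j<i. {x \<in> space N. \<Psi> x \<inter> cell d (j # l') \<noteq> {}})" (is "?L = ?R")
      proof (intro set_eqI iffI)
        fix x assume "x \<in> ?L"
        then have x: "x \<in> space N" "?addr k x = l'" and i: "i = (LEAST i. \<Psi> x \<inter> cell d (i # l') \<noteq> {})"
          by (auto simp: Cons)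
        have "\<Psi> x \<inter> cell d (i # l') \<noteq> {}"
          unfolding i by (rule LeastI_ex) (use ex[OF x(1), of k] x(2) in auto)
        moreover have "\<not> \<Psi> x \<inter> cell d (j # l') \<noteq> {}" if "j < i" for j
          using that unfolding i by (rule not_less_Least)
        ultimately show "x \<in> ?R"
          using x by blast
      next
        fix x assume x: "x \<in> ?R"
        then have "(LEAST i. \<Psi> x \<inter> cell d (i # l') \<noteq> {}) = i"
          by (intro Least_equality) (auto simp del: cell.simps simp: not_less[symmetric])
        with x show "x \<in> ?L"
          by (simp add: Cons del: cell.simps)
      qed
      moreover have "?R \<in> sets N"
        by (intro sets.Diff sets.Int sets.finite_UN Suc.IH hits closed_cell) auto
      ultimately show ?thesis by simp
    qed simp
  qed
  have addr_measurable: "?addr k \<in> N \<rightarrow>\<^sub>M count_space UNIV" for k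
  proof (subst measurable_count_space_eq_countable)
    show "?addr k \<in> space N \<rightarrow> UNIV \<and> (\<forall>l\<in>UNIV. ?addr k -` {l} \<inter> space N \<in> sets N)"
      using addr_sets[of k] by (auto simp: vimage_def Int_def conj_commute)
  qed simp
  define f where "f k x = d (hd (?addr (Suc k) x))" for k x
  have f_measurable: "f k \<in> N \<rightarrow>\<^sub>M borel" for k
    unfolding f_def[abs_def] by (rule measurable_compose[OF addr_measurable]) simp

  have "\<exists>y\<in>\<Psi> x. (\<lambda>k. f k x) \<longlonglongrightarrow> y" if x: "x \<in> space N" for x
  proof -
    have "\<Psi> x \<inter> (\<Inter>k\<in>UNIV. cell d (?addr k x)) \<noteq> {}"
    proof (rule compact_imp_fip_image[OF compact[OF x] closed_cell])
      fix I :: "nat set" assume "finite I"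
      then have "cell d (?addr (Max (insert 0 I)) x) \<subseteq> (\<Inter>k\<in>I. cell d (?addr k x))"
        by (intro INF_greatest cell_address_decreasing) auto
      then show "\<Psi> x \<inter> (\<Inter>k\<in>I. cell d (?addr k x)) \<noteq> {}"
        using cell_address_meets[OF d ne[OF x], of "Max (insert 0 I)"] by blast
    qed
    then obtain y where y: "y \<in> \<Psi> x" "\<And>k. y \<in> cell d (?addr k x)"
      by blast
    have "dist (f k x) y \<le> (1/2) ^ k" for k
      using y(2)[of "Suc k"] by (simp add: f_def)
    then have "(\<lambda>k. dist (f k x) y) \<longlonglongrightarrow> 0"
      by (intro tendsto_sandwich[OF _ _ tendsto_const LIMSEQ_power_zero[of "1/2 :: real"]]) auto
    with y(1) show ?thesis
      by (subst (asm) tendsto_dist_iff[symmetric]) blast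
  qed
  then obtain \<phi> where \<phi>: "\<And>x. x \<in> space N \<Longrightarrow> \<phi> x \<in> \<Psi> x" "\<And>x. x \<in> space N \<Longrightarrow> (\<lambda>k. f k x) \<longlonglongrightarrow> \<phi> x"
    by metis
  have "\<phi> \<in> N \<rightarrow>\<^sub>M borel"
    by (rule borel_measurable_LIMSEQ_metric[OF f_measurable \<phi>(2)])
  with \<phi>(1) show ?thesis by blast
qed

section \<open>Parametric minimization\<close>

text \<open>
  The compactness part of \<open>K\<close>-inf-compactness.  It concerns actions along a convergent sequence
  of states and not only the level sets at a single state, because the minimum over actions has to be
  compared at neighbouring states.
\<close>

definition sequentially_inf_compact :: "'x::topological_space set \<Rightarrow> ('x \<Rightarrow> 'a::topological_space set) \<Rightarrow> ('x \<times> 'a \<Rightarrow> ennreal) \<Rightarrow> bool" where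
  "sequentially_inf_compact S A g \<longleftrightarrow>
     (\<forall>x l a t. (\<forall>n. x n \<in> S) \<longrightarrow> l \<in> S \<longrightarrow> x \<longlonglongrightarrow> l \<longrightarrow> (\<forall>n. a n \<in> A (x n)) \<longrightarrow>
        t < top \<longrightarrow> (\<forall>n. g (x n, a n) \<le> t) \<longrightarrow>
        (\<exists>b\<in>A l. \<exists>r. strict_mono r \<and> (a \<circ> r) \<longlonglongrightarrow> b))"

lemma sequentially_inf_compact_mono:
  assumes "sequentially_inf_compact S A g" "\<And>z. z \<in> Sigma S A \<Longrightarrow> g z \<le> g' z"
  shows "sequentially_inf_compact S A g'"
  unfolding sequentially_inf_compact_def
proof (intro allI impI)
  fix x l a t
  assume *: "\<forall>n. x n \<in> S" "l \<in> S" "x \<longlonglongrightarrow> l" "\<forall>n. a n \<in> A (x n)" "t < top" "\<forall>n. g' (x n, a n) \<le> t"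
  then have "g (x n, a n) \<le> t" for n
    using assms(2)[of "(x n, a n)"] by (auto intro: order_trans)
  with * assms(1) show "\<exists>b\<in>A l. \<exists>r. strict_mono r \<and> (a \<circ> r) \<longlonglongrightarrow> b"
    unfolding sequentially_inf_compact_def by blast
qed

lemma ennreal_less_add_one: "x < top \<Longrightarrow> x < x + (1::ennreal)"
  by (cases x) (auto simp: ennreal_less_iff simp flip: ennreal_1 ennreal_plus)

context
  fixes S :: "'x::polish_space set" and A :: "'x \<Rightarrow> 'a::polish_space set"
    and g :: "'x \<times> 'a \<Rightarrow> ennreal"
  assumes lsc: "seq_lsc (Sigma S A) g" and cpt: "sequentially_inf_compact S A g"
begin

lemma limit_action:
  assumes x: "\<And>n. x n \<in> S" "l \<in> S" "x \<longlonglongrightarrow> l" and a: "\<And>n. a n \<in> A (x n)"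
    and t: "t < top" "\<And>n. g (x n, a n) \<le> t"
  obtains b r where "b \<in> A l" "strict_mono (r :: nat \<Rightarrow> nat)" "(a \<circ> r) \<longlonglongrightarrow> b"
    "g (l, b) \<le> liminf (\<lambda>n. g (x (r n), a (r n)))"
proof -
  obtain b r where b: "b \<in> A l" and r: "strict_mono (r :: nat \<Rightarrow> nat)" "(a \<circ> r) \<longlonglongrightarrow> b"
    using cpt[unfolded sequentially_inf_compact_def, rule_format, of x l a t] assms by blast
  have "(\<lambda>n. (x (r n), a (r n))) \<longlonglongrightarrow> (l, b)"
    using LIMSEQ_subseq_LIMSEQ[OF x(3) r(1)] r(2) by (intro tendsto_Pair) (auto simp: comp_def)
  then have "g (l, b) \<le> liminf (\<lambda>n. g (x (r n), a (r n)))"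
    using seq_lscD[OF lsc, of "\<lambda>n. (x (r n), a (r n))" "(l, b)"] x a b by auto
  with b r show thesis by (rule that)
qed

lemma min_attained_on:
  assumes x: "x \<in> S" and F: "closed F" and fin: "(INF a\<in>A x \<inter> F. g (x, a)) < top"
  shows "\<exists>a\<in>A x \<inter> F. g (x, a) = (INF a\<in>A x \<inter> F. g (x, a))"
proof -
  let ?v = "INF a\<in>A x \<inter> F. g (x, a)"
  have "(\<lambda>a. g (x, a)) ` (A x \<inter> F) \<noteq> {}"
    using fin by auto
  from Inf_as_limit[OF this] obtain u where
    u: "\<And>n. u n \<in> (\<lambda>a. g (x, a)) ` (A x \<inter> F)" "u \<longlonglongrightarrow> ?v"
    by blast
  have "\<forall>\<^sub>F n in sequentially. u n < ?v + 1"
    by (rule order_tendstoD(2)[OF u(2)]) (rule ennreal_less_add_one[OF fin])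
  then obtain n0 where n0: "\<And>n. n0 \<le> n \<Longrightarrow> u n < ?v + 1"
    unfolding eventually_sequentially by blast
  obtain a where a: "\<And>n. a n \<in> A x \<inter> F" "\<And>n. u n = g (x, a n)"
    using u(1) unfolding image_iff by metis
  let ?a = "\<lambda>n. a (n + n0)"
  obtain b r where b: "b \<in> A x" and r: "strict_mono (r :: nat \<Rightarrow> nat)" "(?a \<circ> r) \<longlonglongrightarrow> b"
    and gb: "g (x, b) \<le> liminf (\<lambda>n. g (x, ?a (r n)))"
  proof (rule limit_action[of "\<lambda>_. x" x ?a "?v + 1"])
    show "g (x, ?a n) \<le> ?v + 1" for n
      using n0[of "n + n0"] a(2)[of "n + n0"] by (simp add: less_imp_le)
  qed (use x a fin in \<open>auto simp: ennreal_add_less_top\<close>)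
  have "b \<in> F"
    by (rule closed_sequentially[OF F _ r(2)]) (use a(1) in auto)
  have "(\<lambda>n. u (r n + n0)) \<longlonglongrightarrow> ?v"
    using LIMSEQ_subseq_LIMSEQ[OF LIMSEQ_ignore_initial_segment[OF u(2), of n0] r(1)] by (simp add: comp_def)
  then have "liminf (\<lambda>n. g (x, ?a (r n))) = ?v"
    unfolding a(2)[symmetric] by (rule lim_imp_Liminf[rotated]) simp
  with gb have "g (x, b) \<le> ?v"
    by simp
  moreover have "?v \<le> g (x, b)"
    using b \<open>b \<in> F\<close> by (intro INF_lower) auto
  ultimately show ?thesis
    using b \<open>b \<in> F\<close> by (intro bexI[of _ b]) auto
qed

lemma min_attained:
  assumes "x \<in> S" "A x \<noteq> {}"
  shows "\<exists>a\<in>A x. g (x, a) = (INF a\<in>A x. g (x, a))"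
proof (cases "(INF a\<in>A x. g (x, a)) < top")
  case True
  then show ?thesis
    using min_attained_on[OF assms(1) closed_UNIV] by simp
next
  case False
  obtain a where a: "a \<in> A x"
    using assms(2) by blast
  with False have "g (x, a) = (INF a\<in>A x. g (x, a))"
    by (metis INF_lower top.extremum_uniqueI less_top)
  with a show ?thesis by blast
qed

text \<open>
  Minimizers along a convergent sequence of states accumulate at an available action, which is
  again in \<open>F\<close>.  The closed set \<open>F\<close> is what the selection lemma below needs.
\<close>

lemma seq_lsc_min_on:
  assumes F: "closed F"
  shows "seq_lsc S (\<lambda>x. INF a\<in>A x \<inter> F. g (x, a))"
proof (rule seq_lscI_level)
  fix x l t
  assume x: "\<And>k. x k \<in> S" "l \<in> S" "x \<longlonglongrightarrow> l" and t: "t < top" "\<And>k. (INF a\<in>A (x k) \<inter> F. g (x k, a)) \<le> t"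
  have "\<exists>a\<in>A (x k) \<inter> F. g (x k, a) \<le> t" for k
    using min_attained_on[OF x(1) F le_less_trans[OF t(2)[of k] t(1)]] t(2)[of k] by metis
  then obtain a where a: "\<And>k. a k \<in> A (x k) \<inter> F" "\<And>k. g (x k, a k) \<le> t"
    by metis
  obtain b r where b: "b \<in> A l" and r: "strict_mono (r :: nat \<Rightarrow> nat)" "(a \<circ> r) \<longlonglongrightarrow> b"
    and gb: "g (l, b) \<le> liminf (\<lambda>n. g (x (r n), a (r n)))"
    by (rule limit_action[OF x _ t(1) a(2)]) (use a in auto)
  have "b \<in> F"
    by (rule closed_sequentially[OF F _ r(2)]) (use a(1) in auto)
  have "(INF a\<in>A l \<inter> F. g (l, a)) \<le> g (l, b)"
    using b \<open>b \<in> F\<close> by (intro INF_lower) auto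
  also have "\<dots> \<le> liminf (\<lambda>n. g (x (r n), a (r n)))"
    by (rule gb)
  also have "\<dots> \<le> liminf (\<lambda>n. t)"
    by (intro Liminf_mono always_eventually) (simp add: a)
  finally show "(INF a\<in>A l \<inter> F. g (l, a)) \<le> t"
    by (simp add: Liminf_const)
qed

lemma seq_lsc_min: "seq_lsc S (\<lambda>x. INF a\<in>A x. g (x, a))"
  using seq_lsc_min_on[OF closed_UNIV] by simp

lemma compact_argmin:
  assumes x: "x \<in> S" and fin: "(INF a\<in>A x. g (x, a)) < top"
  shows "compact {a \<in> A x. g (x, a) = (INF a\<in>A x. g (x, a))}" (is "compact ?K")
  unfolding compact_eq_seq_compact_metric seq_compact_def
proof (intro allI impI)
  fix a :: "nat \<Rightarrow> 'a" assume a: "\<forall>n. a n \<in> ?K"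
  let ?v = "INF a\<in>A x. g (x, a)"
  obtain b r where b: "b \<in> A x" and r: "strict_mono (r :: nat \<Rightarrow> nat)" "(a \<circ> r) \<longlonglongrightarrow> b"
    and gb: "g (x, b) \<le> liminf (\<lambda>n. g (x, a (r n)))"
    by (rule limit_action[of "\<lambda>_. x" x a ?v]) (use a x fin in auto)
  have "g (x, b) \<le> ?v"
    using gb a by (simp add: Liminf_const)
  then have "b \<in> ?K"
    using b by (auto intro!: antisym INF_lower)
  with r show "\<exists>b\<in>?K. \<exists>r. strict_mono r \<and> (a \<circ> r) \<longlonglongrightarrow> b"
    by blast
qed

text \<open>
  Where the minimum is infinite every action is a minimizer, so the given selector \<open>\<phi>\<^sub>0\<close>
  serves; elsewhere the minimizers form a compact set, and that set meets \<open>F\<close> exactly if the minimum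
  over \<open>F\<close> agrees with the full minimum.
\<close>

lemma measurable_argmin_selection:
  assumes S: "S \<in> sets borel" and \<phi>\<^sub>0: "\<phi>\<^sub>0 \<in> borel_on S \<rightarrow>\<^sub>M borel" "\<And>x. x \<in> S \<Longrightarrow> \<phi>\<^sub>0 x \<in> A x"
  shows "\<exists>\<phi>\<in>borel_on S \<rightarrow>\<^sub>M borel. \<forall>x\<in>S. \<phi> x \<in> A x \<and> g (x, \<phi> x) = (INF a\<in>A x. g (x, a))"
proof -
  let ?v = "\<lambda>x. INF a\<in>A x. g (x, a)" and ?K = "\<lambda>x. {a \<in> A x. g (x, a) = (INF a\<in>A x. g (x, a))}"
  let ?N = "restrict_space (borel_on S) {x. ?v x < top}"
  have v[measurable]: "?v \<in> borel_measurable (borel_on S)"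
    by (rule borel_measurable_seq_lsc[OF seq_lsc_min])
  have fin: "{x \<in> space (borel_on S). ?v x < top} \<in> sets (borel_on S)"
    by measurable
  have space_N: "space ?N = {x \<in> S. ?v x < top}"
    by (auto simp: space_restrict_space)
  have "\<exists>\<phi>\<in>?N \<rightarrow>\<^sub>M borel. \<forall>x\<in>space ?N. \<phi> x \<in> ?K x"
  proof (rule compact_valued_selection)
    fix x assume "x \<in> space ?N"
    then have x: "x \<in> S" "?v x < top" by (auto simp: space_N)
    show "compact (?K x)"
      by (rule compact_argmin[OF x])
    show "?K x \<noteq> {}"
      using min_attained_on[OF x(1) closed_UNIV] x(2) by auto
  next
    fix F :: "'a set" assume F: "closed F"
    let ?w = "\<lambda>x. INF a\<in>A x \<inter> F. g (x, a)"
    have w: "?w \<in> borel_measurable (borel_on S)"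
      by (rule borel_measurable_seq_lsc[OF seq_lsc_min_on[OF F]])
    note [measurable] = measurable_restrict_space1[OF v] measurable_restrict_space1[OF w]
    have "{x \<in> space ?N. ?K x \<inter> F \<noteq> {}} = {x \<in> space ?N. ?w x = ?v x}"
    proof (intro Collect_cong conj_cong refl iffI)
      fix x assume "x \<in> space ?N" "?K x \<inter> F \<noteq> {}"
      then obtain a where "a \<in> A x \<inter> F" "g (x, a) = ?v x" by blast
      then have "?w x \<le> ?v x" by (metis INF_lower)
      moreover have "?v x \<le> ?w x" by (intro INF_superset_mono) auto
      ultimately show "?w x = ?v x" by (rule antisym)
    next
      fix x assume "x \<in> space ?N" "?w x = ?v x"
      then show "?K x \<inter> F \<noteq> {}"
        using min_attained_on[OF _ F, of x] by (auto simp: space_N)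
    qed
    also have "\<dots> \<in> sets ?N"
      by measurable
    finally show "{x \<in> space ?N. ?K x \<inter> F \<noteq> {}} \<in> sets ?N" .
  qed
  then obtain \<phi> where \<phi>: "\<phi> \<in> ?N \<rightarrow>\<^sub>M borel" "\<And>x. x \<in> S \<Longrightarrow> ?v x < top \<Longrightarrow> \<phi> x \<in> ?K x"
    by (auto simp: space_N)
  let ?\<psi> = "\<lambda>x. if ?v x < top then \<phi> x else \<phi>\<^sub>0 x"
  have "?\<psi> \<in> borel_on S \<rightarrow>\<^sub>M borel"
    by (rule measurable_If_restrict_space_iff[THEN iffD2, OF fin])
       (use \<phi>(1) measurable_restrict_space1[OF \<phi>\<^sub>0(1)] in blast)
  moreover have "?\<psi> x \<in> A x \<and> g (x, ?\<psi> x) = ?v x" if x: "x \<in> S" for x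
  proof (cases "?v x < top")
    case False
    then have "?v x = top" using top.not_eq_extremum by blast
    moreover have "?v x \<le> g (x, \<phi>\<^sub>0 x)"
      using \<phi>\<^sub>0(2)[OF x] by (rule INF_lower)
    ultimately show ?thesis
      using \<phi>\<^sub>0(2)[OF x] False by (metis top.extremum_uniqueI)
  qed (use \<phi>(2)[OF x] in simp)
  ultimately show ?thesis
    by (intro bexI[where x="?\<psi>"] ballI)
qed

end

section \<open>Trajectory measures\<close>

lemma Gr_in_step_space:
  assumes M: "is_mdp M" shows "Gr M \<in> sets (step_space M)"
proof -
  have "states M \<times> actions M \<in> sets borel"
    using M pair_measureI[of "states M" borel "actions M" borel] by (simp only: borel_prod is_mdp_def)
  moreover have "Gr M \<subseteq> states M \<times> actions M" "Gr M \<in> sets borel"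
    using M by (auto simp: is_mdp_def Gr_def)
  ultimately show ?thesis
    unfolding sets_step_space[OF M] by (simp add: sets_restrict_space_iff)
qed

lemma restrict_step_space_Gr:
  assumes M: "is_mdp M" shows "sets (restrict_space (step_space M) (Gr M)) = sets (borel_on (Gr M))"
proof -
  have "states M \<times> actions M \<in> sets borel"
    using M pair_measureI[of "states M" borel "actions M" borel] by (simp only: borel_prod is_mdp_def)
  moreover have Gr: "Gr M \<subseteq> states M \<times> actions M"
    using M by (auto simp: is_mdp_def Gr_def)
  ultimately have "sets (restrict_space (borel_on (states M \<times> actions M)) (Gr M)) = sets (borel_on (Gr M))"
    using M by (simp add: restrict_restrict_space Int_absorb1 is_mdp_def)
  then show ?thesis
    using sets_restrict_space_cong[OF sets_step_space[OF M]] by simp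
qed

text \<open>
  Costs and kernels are measurable on the graph only; cutting them off outside the graph makes
  them measurable on the space of all steps, and does not matter for integrals along trajectories.
\<close>

lemma measurable_on_graph:
  fixes h :: "_ \<Rightarrow> ennreal"
  assumes M: "is_mdp M" and h: "h \<in> borel_measurable (borel_on (Gr M))"
  shows "(\<lambda>z. h z * indicator (Gr M) z) \<in> borel_measurable (step_space M)"
proof -
  have "h \<in> borel_measurable (restrict_space (step_space M) (Gr M))"
    using h unfolding measurable_cong_sets[OF restrict_step_space_Gr[OF M] refl] .
  then show ?thesis
    using Gr_in_step_space[OF M] by (subst (asm) borel_measurable_restrict_space_iff_ennreal) auto
qed

abbreviation prefix_space :: "('x::polish_space, 'a::polish_space) mdp \<Rightarrow> nat \<Rightarrow> (nat \<Rightarrow> 'x \<times> 'a) measure" where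
  "prefix_space M n \<equiv> PiM {0..<n} (\<lambda>_. step_space M)"

context
  fixes M :: "('x::polish_space, 'a::polish_space) mdp" and \<pi> :: "('x, 'a) policy" and x :: 'x
  assumes M: "is_mdp M" and pol: "is_policy M \<pi>" and x: "x \<in> states M"
begin

interpretation IT: Ionescu_Tulcea "next_step M \<pi> x" "\<lambda>_. step_space M"
  by (rule Ionescu_Tulcea_next_step[OF M pol x])

lemma sets_traj [measurable_cong]: "sets (traj_measure M \<pi> x) = sets (PiM UNIV (\<lambda>_. step_space M))"
  unfolding traj_measure_def by simp

lemma prob_space_traj: "prob_space (traj_measure M \<pi> x)"
proof (rule prob_space_distrD)
  show "(\<lambda>\<omega>. restrict \<omega> {}) \<in> traj_measure M \<pi> x \<rightarrow>\<^sub>M PiM {} (\<lambda>_. step_space M)"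
    unfolding measurable_cong_sets[OF sets_traj refl] by (rule measurable_restrict_subset) simp
  show "prob_space (distr (traj_measure M \<pi> x) (PiM {} (\<lambda>_. step_space M)) (\<lambda>\<omega>. restrict \<omega> {}))"
    unfolding distr_traj_measure[OF M pol x finite.emptyI] by (rule IT.PF.prob_space_P) auto
qed

lemma measurable_coordinate [measurable]: "(\<lambda>\<omega>. \<omega> n) \<in> traj_measure M \<pi> x \<rightarrow>\<^sub>M step_space M"
  unfolding measurable_cong_sets[OF sets_traj refl] by (rule measurable_component_singleton) simp

lemma measurable_prefix [measurable]: "(\<lambda>\<omega>. restrict \<omega> {0..<n}) \<in> traj_measure M \<pi> x \<rightarrow>\<^sub>M prefix_space M n"
  unfolding measurable_cong_sets[OF sets_traj refl] by (rule measurable_restrict_subset) simp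

lemma distr_prefix:
  "distr (traj_measure M \<pi> x) (prefix_space M n) (\<lambda>\<omega>. restrict \<omega> {0..<n}) = IT.C 0 n (\<lambda>_. undefined)"
proof (rule measure_eqI)
  have u: "(\<lambda>_. undefined) \<in> space (PiM {0..<0::nat} (\<lambda>_. step_space M))"
    by (simp add: space_PiM)
  show *: "sets (distr (traj_measure M \<pi> x) (prefix_space M n) (\<lambda>\<omega>. restrict \<omega> {0..<n})) = sets (IT.C 0 n (\<lambda>_. undefined))"
    using IT.sets_C[OF u, of n] by simp
  fix X assume "X \<in> sets (distr (traj_measure M \<pi> x) (prefix_space M n) (\<lambda>\<omega>. restrict \<omega> {0..<n}))"
  then have X: "X \<in> sets (prefix_space M n)"
    by simp
  have "prod_emb {0..<n} (\<lambda>_. step_space M) {0..<n} X = X"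
    by (rule prod_emb_id) (use sets.sets_into_space[OF X] in \<open>simp add: space_PiM\<close>)
  then show "emeasure (distr (traj_measure M \<pi> x) (prefix_space M n) (\<lambda>\<omega>. restrict \<omega> {0..<n})) X = emeasure (IT.C 0 n (\<lambda>_. undefined)) X"
    unfolding distr_traj_measure[OF M pol x finite_atLeastLessThan]
    using IT.emeasure_CI[OF subset_refl X] by simp
qed

lemma next_state_in_prob_algebra:
  assumes h: "h \<in> space (prefix_space M n)"
  shows "next_state M x n h \<in> space (prob_algebra (borel_on (states M)))"
  using measurable_space[OF measurable_next_state[OF M x] h] .

lemma policy_in_prob_algebra:
  assumes h: "h \<in> space (prefix_space M n)" and y: "y \<in> states M"
  shows "\<pi> n (h, y) \<in> space (prob_algebra (borel_on (actions M)))"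
proof (rule measurable_space[of "\<pi> n"])
  show "\<pi> n \<in> history_space M n \<rightarrow>\<^sub>M prob_algebra (borel_on (actions M))"
    using pol by (simp add: is_policy_def)
  show "(h, y) \<in> space (history_space M n)"
    using h y by (simp add: space_pair_measure space_restrict_space)
qed

text \<open>
  The Ionescu-Tulcea construction extends the law of the first \<open>n\<close> steps by one step of
  \<open>next_step\<close>.
\<close>

lemma nn_integral_coordinate:
  assumes f: "f \<in> borel_measurable (step_space M)"
  shows "(\<integral>\<^sup>+\<omega>. f (\<omega> n) \<partial>traj_measure M \<pi> x) = (\<integral>\<^sup>+\<omega>. (\<integral>\<^sup>+z. f z \<partial>next_step M \<pi> x n (restrict \<omega> {0..<n})) \<partial>traj_measure M \<pi> x)"
proof -
  let ?C = "\<lambda>n. IT.C 0 n (\<lambda>_. undefined)"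
  have u: "(\<lambda>_. undefined) \<in> space (PiM {0..<0::nat} (\<lambda>_. step_space M))"
    by (simp add: space_PiM)
  have fn: "(\<lambda>h. f (h n)) \<in> borel_measurable (prefix_space M (Suc n))"
    by (rule measurable_compose[OF measurable_component_singleton[of n] f]) simp
  have inner: "(\<lambda>h. \<integral>\<^sup>+z. f z \<partial>next_step M \<pi> x n h) \<in> borel_measurable (prefix_space M n)"
    by (rule measurable_compose[OF measurable_prob_algebraD[OF measurable_next_step[OF M pol x]]
          nn_integral_measurable_subprob_algebra[OF f]])
  have sC: "sets (?C n) = sets (prefix_space M n)" for n
    using IT.sets_C[OF u, of n] by simp
  have "(\<integral>\<^sup>+\<omega>. f (\<omega> n) \<partial>traj_measure M \<pi> x) = (\<integral>\<^sup>+h. f (h n) \<partial>distr (traj_measure M \<pi> x) (prefix_space M (Suc n)) (\<lambda>\<omega>. restrict \<omega> {0..<Suc n}))"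
    by (subst nn_integral_distr[OF measurable_prefix]) (use fn in auto)
  also have "\<dots> = (\<integral>\<^sup>+h. f (h n) \<partial>(?C n \<bind> IT.eP n))"
    unfolding distr_prefix by simp
  also have "\<dots> = (\<integral>\<^sup>+h. (\<integral>\<^sup>+h'. f (h' n) \<partial>IT.eP n h) \<partial>?C n)"
    by (rule nn_integral_bind[OF fn]) (use IT.measurable_eP[of n] in \<open>simp add: measurable_cong_sets[OF sC refl]\<close>)
  also have "\<dots> = (\<integral>\<^sup>+h. (\<integral>\<^sup>+z. f z \<partial>next_step M \<pi> x n h) \<partial>?C n)"
    by (rule nn_integral_cong) (simp add: IT.nn_integral_eP[OF _ fn] sets_eq_imp_space_eq[OF sC])
  also have "\<dots> = (\<integral>\<^sup>+\<omega>. (\<integral>\<^sup>+z. f z \<partial>next_step M \<pi> x n (restrict \<omega> {0..<n})) \<partial>traj_measure M \<pi> x)"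
    unfolding distr_prefix[symmetric] by (rule nn_integral_distr[OF measurable_prefix]) (use inner in simp)
  finally show ?thesis .
qed

lemma nn_integral_next_step:
  assumes f[measurable]: "f \<in> borel_measurable (step_space M)" and h: "h \<in> space (prefix_space M n)"
  shows "(\<integral>\<^sup>+z. f z \<partial>next_step M \<pi> x n h) = (\<integral>\<^sup>+y. \<integral>\<^sup>+a. f (y, a) \<partial>\<pi> n (h, y) \<partial>next_state M x n h)"
proof -
  have sn: "sets (next_state M x n h) = sets (borel_on (states M))"
    using next_state_in_prob_algebra[OF h] by (simp add: space_prob_algebra)
  note [measurable_cong] = sn
  have [measurable]: "\<pi> n \<in> history_space M n \<rightarrow>\<^sub>M prob_algebra (borel_on (actions M))"
    using pol by (simp add: is_policy_def)
  have *: "(\<lambda>y. \<pi> n (h, y) \<bind> (\<lambda>a. return (step_space M) (y, a)))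
      \<in> borel_on (states M) \<rightarrow>\<^sub>M prob_algebra (step_space M)"
    using h by measurable
  have "(\<integral>\<^sup>+z. f z \<partial>next_step M \<pi> x n h) =
      (\<integral>\<^sup>+y. \<integral>\<^sup>+z. f z \<partial>(\<pi> n (h, y) \<bind> (\<lambda>a. return (step_space M) (y, a))) \<partial>next_state M x n h)"
    unfolding next_step_def
    by (rule nn_integral_bind[OF f])
       (use measurable_prob_algebraD[OF *] in \<open>simp add: measurable_cong_sets[OF sn refl]\<close>)
  also have "\<dots> = (\<integral>\<^sup>+y. \<integral>\<^sup>+a. f (y, a) \<partial>\<pi> n (h, y) \<partial>next_state M x n h)"
  proof (rule nn_integral_cong)
    fix y assume "y \<in> space (next_state M x n h)"
    then have y: "y \<in> states M"
      by (simp add: sets_eq_imp_space_eq[OF sn] space_restrict_space)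
    have sp: "sets (\<pi> n (h, y)) = sets (borel_on (actions M))"
      using policy_in_prob_algebra[OF h y] by (simp add: space_prob_algebra)
    have y': "y \<in> space (borel_on (states M))"
      using y by (simp add: space_restrict_space)
    have "(\<lambda>a. return (step_space M) (y, a)) \<in> borel_on (actions M) \<rightarrow>\<^sub>M subprob_algebra (step_space M)"
      by (rule measurable_compose[OF measurable_Pair1'[OF y'] return_measurable])
    then have "(\<integral>\<^sup>+z. f z \<partial>(\<pi> n (h, y) \<bind> (\<lambda>a. return (step_space M) (y, a)))) =
        (\<integral>\<^sup>+a. \<integral>\<^sup>+z. f z \<partial>return (step_space M) (y, a) \<partial>\<pi> n (h, y))"
      by (intro nn_integral_bind[OF f]) (simp add: measurable_cong_sets[OF sp refl])
    also have "\<dots> = (\<integral>\<^sup>+a. f (y, a) \<partial>\<pi> n (h, y))"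
      by (intro nn_integral_cong nn_integral_return)
         (use y f sets_eq_imp_space_eq[OF sp] in \<open>auto simp: space_pair_measure space_restrict_space\<close>)
    finally show "(\<integral>\<^sup>+z. f z \<partial>(\<pi> n (h, y) \<bind> (\<lambda>a. return (step_space M) (y, a)))) = (\<integral>\<^sup>+a. f (y, a) \<partial>\<pi> n (h, y))" .
  qed
  finally show ?thesis .
qed

lemma nn_integral_coordinate_next:
  assumes f: "f \<in> borel_measurable (step_space M)"
  shows "(\<integral>\<^sup>+\<omega>. f (\<omega> n) \<partial>traj_measure M \<pi> x) =
    (\<integral>\<^sup>+\<omega>. \<integral>\<^sup>+y. \<integral>\<^sup>+a. f (y, a) \<partial>\<pi> n (restrict \<omega> {0..<n}, y) \<partial>next_state M x n (restrict \<omega> {0..<n}) \<partial>traj_measure M \<pi> x)"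
  unfolding nn_integral_coordinate[OF f]
  by (rule nn_integral_cong) (intro nn_integral_next_step f measurable_space[OF measurable_prefix])

text \<open>
  A property of a single step holds almost surely if it does so under the conditional laws of the
  state and of the action, whatever the history: integrate the indicator of its complement.
\<close>

lemma AE_coordinate:
  assumes Q: "Measurable.pred (step_space M) Q"
    and AE: "\<And>h. h \<in> space (prefix_space M n) \<Longrightarrow>
      AE y in next_state M x n h. AE a in \<pi> n (h, y). Q (y, a)"
  shows "AE \<omega> in traj_measure M \<pi> x. Q (\<omega> n)"
proof -
  let ?f = "indicator {z \<in> space (step_space M). \<not> Q z} :: _ \<Rightarrow> ennreal"
  have f: "?f \<in> borel_measurable (step_space M)"
    using Q by measurable
  have "(\<integral>\<^sup>+\<omega>. ?f (\<omega> n) \<partial>traj_measure M \<pi> x) = (\<integral>\<^sup>+\<omega>. 0 \<partial>traj_measure M \<pi> x)"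
    unfolding nn_integral_coordinate_next[OF f]
  proof (rule nn_integral_cong)
    fix \<omega> assume "\<omega> \<in> space (traj_measure M \<pi> x)"
    then have h: "restrict \<omega> {0..<n} \<in> space (prefix_space M n)"
      by (rule measurable_space[OF measurable_prefix])
    have "(\<integral>\<^sup>+y. \<integral>\<^sup>+a. ?f (y, a) \<partial>\<pi> n (restrict \<omega> {0..<n}, y) \<partial>next_state M x n (restrict \<omega> {0..<n})) =
        (\<integral>\<^sup>+y. 0 \<partial>next_state M x n (restrict \<omega> {0..<n}))"
    proof (rule nn_integral_cong_AE, rule AE_mp[OF AE[OF h]], rule AE_I2, rule impI)
      fix y assume "AE a in \<pi> n (restrict \<omega> {0..<n}, y). Q (y, a)"
      then have "AE a in \<pi> n (restrict \<omega> {0..<n}, y). ?f (y, a) = 0"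
        by eventually_elim simp
      then show "(\<integral>\<^sup>+a. ?f (y, a) \<partial>\<pi> n (restrict \<omega> {0..<n}, y)) = 0"
        using nn_integral_cong_AE[of "\<lambda>a. ?f (y, a)" "\<lambda>_. 0"] by simp
    qed
    then show "(\<integral>\<^sup>+y. \<integral>\<^sup>+a. ?f (y, a) \<partial>\<pi> n (restrict \<omega> {0..<n}, y) \<partial>next_state M x n (restrict \<omega> {0..<n})) = 0"
      by simp
  qed
  then have "(\<integral>\<^sup>+\<omega>. ?f (\<omega> n) \<partial>traj_measure M \<pi> x) = 0"
    by simp
  then have "AE \<omega> in traj_measure M \<pi> x. ?f (\<omega> n) = 0"
    by (rule nn_integral_0_iff_AE[OF measurable_compose[OF measurable_coordinate f], THEN iffD1])
  with AE_space[of "traj_measure M \<pi> x"] show ?thesis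
  proof eventually_elim
    case (elim \<omega>)
    then show ?case
      using measurable_space[OF measurable_coordinate elim(1), of n] by (auto split: split_indicator_asm)
  qed
qed

lemma AE_in_graph: "AE \<omega> in traj_measure M \<pi> x. \<omega> n \<in> Gr M"
proof (rule AE_coordinate)
  show "Measurable.pred (step_space M) (\<lambda>z. z \<in> Gr M)"
    by (rule pred_sets2[OF Gr_in_step_space[OF M]]) simp
  fix h assume h: "h \<in> space (prefix_space M n)"
  have sn: "sets (next_state M x n h) = sets (borel_on (states M))"
    using next_state_in_prob_algebra[OF h] by (simp add: space_prob_algebra)
  show "AE y in next_state M x n h. AE a in \<pi> n (h, y). (y, a) \<in> Gr M"
  proof (rule AE_I2)
    fix y assume "y \<in> space (next_state M x n h)"
    then have y: "y \<in> states M"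
      by (simp add: sets_eq_imp_space_eq[OF sn] space_restrict_space)
    interpret prob_space "\<pi> n (h, y)"
      using policy_in_prob_algebra[OF h y] by (simp add: space_prob_algebra)
    have "avail M y \<in> sets (\<pi> n (h, y))"
      using policy_in_prob_algebra[OF h y] M y
      by (auto simp: space_prob_algebra is_mdp_def sets_restrict_space_iff)
    moreover have "emeasure (\<pi> n (h, y)) (avail M y) = 1"
      using pol h y by (auto simp: is_policy_def space_pair_measure space_restrict_space)
    ultimately have "AE a in \<pi> n (h, y). a \<in> avail M y"
      by (simp add: AE_in_set_eq_1 measure_def)
    then show "AE a in \<pi> n (h, y). (y, a) \<in> Gr M"
      by eventually_elim (use y in \<open>simp add: Gr_def\<close>)
  qed
qed

lemma nn_integral_initial_state:
  assumes f: "f \<in> borel_measurable (borel_on (states M))"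
  shows "(\<integral>\<^sup>+\<omega>. f (fst (\<omega> 0)) \<partial>traj_measure M \<pi> x) = f x"
proof -
  have *: "(\<lambda>z. f (fst z)) \<in> borel_measurable (step_space M)"
    by (rule measurable_compose[OF measurable_fst f])
  have x': "x \<in> space (borel_on (states M))"
    using x by (simp add: space_restrict_space)
  have "(\<integral>\<^sup>+\<omega>. f (fst (\<omega> 0)) \<partial>traj_measure M \<pi> x) = (\<integral>\<^sup>+\<omega>. f x \<partial>traj_measure M \<pi> x)"
    unfolding nn_integral_coordinate_next[OF *]
  proof (rule nn_integral_cong)
    fix \<omega> assume "\<omega> \<in> space (traj_measure M \<pi> x)"
    then have h: "restrict \<omega> {0..<0} \<in> space (prefix_space M 0)"
      by (rule measurable_space[OF measurable_prefix])
    have "(\<integral>\<^sup>+y. \<integral>\<^sup>+a. f (fst (y, a)) \<partial>\<pi> 0 (restrict \<omega> {0..<0}, y) \<partial>next_state M x 0 (restrict \<omega> {0..<0}))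
      = (\<integral>\<^sup>+y. f y \<partial>return (borel_on (states M)) x)"
      unfolding next_state_def if_P[OF refl]
    proof (rule nn_integral_cong)
      fix y assume "y \<in> space (return (borel_on (states M)) x)"
      then interpret prob_space "\<pi> 0 (restrict \<omega> {0..<0}, y)"
        using policy_in_prob_algebra[OF h, of y] by (simp add: space_prob_algebra space_restrict_space)
      show "(\<integral>\<^sup>+a. f (fst (y, a)) \<partial>\<pi> 0 (restrict \<omega> {0..<0}, y)) = f y"
        by (simp only: fst_conv nn_integral_const emeasure_space_1 mult_1_right)
    qed
    also have "\<dots> = f x"
      by (rule nn_integral_return[OF x' f])
    finally show "(\<integral>\<^sup>+y. \<integral>\<^sup>+a. f (fst (y, a)) \<partial>\<pi> 0 (restrict \<omega> {0..<0}, y) \<partial>next_state M x 0 (restrict \<omega> {0..<0})) = f x" .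
  qed
  also have "\<dots> = f x"
    using prob_space.emeasure_space_1[OF prob_space_traj] by simp
  finally show ?thesis .
qed

text \<open>
  Almost surely the step \<open>\<omega> n\<close> lies in the graph, and there the next state has law
  \<open>kernel M (\<omega> n)\<close>.
\<close>

lemma nn_integral_next_state:
  assumes f: "f \<in> borel_measurable (borel_on (states M))"
  shows "(\<integral>\<^sup>+\<omega>. f (fst (\<omega> (Suc n))) \<partial>traj_measure M \<pi> x) = (\<integral>\<^sup>+\<omega>. (\<integral>\<^sup>+y. f y \<partial>kernel M (\<omega> n)) \<partial>traj_measure M \<pi> x)"
proof -
  have *: "(\<lambda>z. f (fst z)) \<in> borel_measurable (step_space M)"
    by (rule measurable_compose[OF measurable_fst f])
  show ?thesis
    unfolding nn_integral_coordinate_next[OF *]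
  proof (rule nn_integral_cong_AE)
    show "AE \<omega> in traj_measure M \<pi> x. (\<integral>\<^sup>+y. \<integral>\<^sup>+a. f (fst (y, a)) \<partial>\<pi> (Suc n) (restrict \<omega> {0..<Suc n}, y)
        \<partial>next_state M x (Suc n) (restrict \<omega> {0..<Suc n})) = (\<integral>\<^sup>+y. f y \<partial>kernel M (\<omega> n))"
      using AE_in_graph[of n] AE_space[of "traj_measure M \<pi> x"]
    proof eventually_elim
      case (elim \<omega>)
      then have h: "restrict \<omega> {0..<Suc n} \<in> space (prefix_space M (Suc n))"
        by (intro measurable_space[OF measurable_prefix])
      have k: "next_state M x (Suc n) (restrict \<omega> {0..<Suc n}) = kernel M (\<omega> n)"
        using elim by (simp add: next_state_def)
      have sk: "space (kernel M (\<omega> n)) = states M"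
        using next_state_in_prob_algebra[OF h]
        sets_eq_imp_space_eq[of "kernel M (\<omega> n)" "borel_on (states M)"]
        unfolding k by (simp add: space_prob_algebra space_restrict_space)
      show ?case
        unfolding k
      proof (rule nn_integral_cong)
        fix y assume "y \<in> space (kernel M (\<omega> n))"
        then interpret prob_space "\<pi> (Suc n) (restrict \<omega> {0..<Suc n}, y)"
          using policy_in_prob_algebra[OF h, of y] by (simp add: space_prob_algebra sk)
        show "(\<integral>\<^sup>+a. f (fst (y, a)) \<partial>\<pi> (Suc n) (restrict \<omega> {0..<Suc n}, y)) = f y"
          by (simp add: emeasure_space_1)
      qed
    qed
  qed
qed

end

lemma AE_markov_action:
  assumes M: "is_mdp M" and \<phi>: "\<And>n. selector M (\<phi> n)" and x: "x \<in> states M"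
  shows "AE \<omega> in traj_measure M (markov M \<phi>) x. snd (\<omega> n) = \<phi> n (fst (\<omega> n))"
proof (rule AE_coordinate[OF M is_policy_markov[OF M \<phi>] x])
  have \<phi>_meas: "\<phi> n \<in> borel_on (states M) \<rightarrow>\<^sub>M borel_on (actions M)"
    using \<phi>[of n] by (simp add: selector_def)
  have \<phi>': "\<phi> n \<in> borel_measurable (borel_on (states M))"
    by (rule measurable_compose[OF \<phi>_meas measurable_restrict_space1[OF measurable_ident_sets[OF refl]]])
  have a: "(\<lambda>z. z) \<in> borel_measurable (borel_on (actions M))"
    by (rule measurable_restrict_space1[OF measurable_ident_sets[OF refl]])
  note [measurable] = measurable_compose[OF measurable_fst \<phi>'] measurable_compose[OF measurable_snd a]
  show "Measurable.pred (step_space M) (\<lambda>z. snd z = \<phi> n (fst z))"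
    by measurable
  fix h assume h: "h \<in> space (PiM {0..<n} (\<lambda>_. step_space M))"
  have sn: "sets (next_state M x n h) = sets (borel_on (states M))"
    using next_state_in_prob_algebra[OF M is_policy_markov[OF M \<phi>] x h] by (simp add: space_prob_algebra)
  show "AE y in next_state M x n h. AE a in markov M \<phi> n (h, y). snd (y, a) = \<phi> n (fst (y, a))"
  proof (rule AE_I2)
    fix y assume "y \<in> space (next_state M x n h)"
    then have "y \<in> space (borel_on (states M))"
      by (simp add: sets_eq_imp_space_eq[OF sn])
    then have "\<phi> n y \<in> space (borel_on (actions M))"
      by (rule measurable_space[OF \<phi>_meas])
    moreover have "Measurable.pred (borel_on (actions M)) (\<lambda>a. a = \<phi> n y)"
      using a by measurable
    ultimately have AE: "AE a in return (borel_on (actions M)) (\<phi> n y). a = \<phi> n y"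
      by (simp only: AE_return)
    have dirac: "markov M \<phi> n (h, y) = return (borel_on (actions M)) (\<phi> n y)"
      by (simp add: markov_def)
    show "AE a in markov M \<phi> n (h, y). snd (y, a) = \<phi> n (fst (y, a))"
      unfolding dirac fst_conv snd_conv by (rule AE)
  qed
qed

section \<open>Extended reals bounded below as shifted nonnegative numbers\<close>

lemma enn2ereal_add: "enn2ereal (x + y) = enn2ereal x + enn2ereal y"
  by (rule plus_ennreal.rep_eq)

text \<open>
  Also true for \<open>a = 0\<close> and \<open>g = \<infinity>\<close>, since both sides use \<open>0 * \<infinity> = 0\<close>.
\<close>

lemma ereal_mult_shifted:
  assumes "0 \<le> a"
  shows "ereal a * (enn2ereal g + ereal s) = enn2ereal (ennreal a * g) + ereal (a * s)"
proof (cases g)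
  case (real r)
  then show ?thesis
    using assms by (simp add: distrib_left flip: ennreal_mult)
next
  case top
  then show ?thesis
    using assms by (cases "a = 0") (auto simp: ennreal_mult_top zero_ennreal.rep_eq)
qed

text \<open>
  The identity \<open>y\<^sup>+ + s\<^sup>- = g + s\<^sup>+ + y\<^sup>-\<close> for \<open>y = g + s\<close>: the equation
  \<open>y\<^sup>+ - y\<^sup>- = g + s\<close> rearranged so that no subtraction is left, which allows it to be integrated.
\<close>

lemma pos_neg_parts_shifted:
  fixes g :: ennreal and s :: real
  shows "e2ennreal (enn2ereal g + ereal s) + ennreal (- s) = g + ennreal s + e2ennreal (- (enn2ereal g + ereal s))"
proof (cases g)
  case (real r)
  then show ?thesis
    by (cases "0 \<le> s"; cases "0 \<le> r + s") (auto simp: ennreal_neg simp flip: ennreal_plus)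
next
  case top
  then show ?thesis by (simp add: e2ennreal_neg)
qed

lemma eintegral_shifted:
  assumes \<mu>: "prob_space \<mu>" and g: "g \<in> borel_measurable \<mu>"
    and f: "AE z in \<mu>. f z = enn2ereal (g z) + ereal s"
  shows "eintegral \<mu> f = enn2ereal (\<integral>\<^sup>+z. g z \<partial>\<mu>) + ereal s"
proof -
  interpret prob_space \<mu> by (rule \<mu>)
  note [measurable] = g
  let ?P = "\<integral>\<^sup>+z. e2ennreal (enn2ereal (g z) + ereal s) \<partial>\<mu>"
  let ?N = "\<integral>\<^sup>+z. e2ennreal (- (enn2ereal (g z) + ereal s)) \<partial>\<mu>"
  have "(\<integral>\<^sup>+z. e2ennreal (f z) \<partial>\<mu>) = ?P" "(\<integral>\<^sup>+z. e2ennreal (- f z) \<partial>\<mu>) = ?N"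
    by (rule nn_integral_cong_AE, use f in eventually_elim, simp)+
  then have I: "eintegral \<mu> f = enn2ereal ?P - enn2ereal ?N"
    by (simp add: eintegral_def)
  have "?P + ennreal (- s) = (\<integral>\<^sup>+z. e2ennreal (enn2ereal (g z) + ereal s) + ennreal (- s) \<partial>\<mu>)"
    by (subst nn_integral_add) (auto simp: emeasure_space_1)
  also have "\<dots> = (\<integral>\<^sup>+z. g z + ennreal s + e2ennreal (- (enn2ereal (g z) + ereal s)) \<partial>\<mu>)"
    by (simp only: pos_neg_parts_shifted)
  also have "\<dots> = (\<integral>\<^sup>+z. g z \<partial>\<mu>) + ennreal s + ?N"
    by (subst nn_integral_add, measurable)+ (simp add: emeasure_space_1)
  finally have eq: "?P + ennreal (- s) = (\<integral>\<^sup>+z. g z \<partial>\<mu>) + ennreal s + ?N" .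
  \<comment> \<open>The negative part has finite integral, so it can be subtracted again.\<close>
  have "?N \<le> (\<integral>\<^sup>+z. ennreal (- s) \<partial>\<mu>)"
  proof (rule nn_integral_mono)
    fix z
    have "- (enn2ereal (g z) + ereal s) \<le> ereal (- s)"
      by (cases "g z") auto
    from e2ennreal_mono[OF this] show "e2ennreal (- (enn2ereal (g z) + ereal s)) \<le> ennreal (- s)"
      by simp
  qed
  then have "?N \<le> ennreal (- s)"
    by (simp add: emeasure_space_1)
  then obtain n where n: "?N = ennreal n" "0 \<le> n"
    by (cases ?N) (auto simp: top_unique)
  show ?thesis
  proof (cases "\<integral>\<^sup>+z. g z \<partial>\<mu>")
    case (real r)
    with eq n have "?P \<noteq> top"
      by (metis ennreal_add_eq_top ennreal_neq_top)
    then obtain p where p: "?P = ennreal p" "0 \<le> p"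
      by (cases ?P) auto
    have "p - n = r + s"
      using eq real n p by (cases "0 \<le> s") (auto simp: ennreal_neg simp flip: ennreal_plus)
    then show ?thesis
      using real n p by (simp add: I)
  next
    case top
    with eq have "?P = top"
      by (auto simp: ennreal_add_eq_top)
    with top n show ?thesis
      by (simp add: I)
  qed
qed

lemma tendsto_shifted:
  assumes "g \<longlonglongrightarrow> G" "s \<longlonglongrightarrow> t"
  shows "(\<lambda>n. enn2ereal (g n) + ereal (s n)) \<longlonglongrightarrow> enn2ereal G + ereal t"
  by (rule tendsto_add_ereal_general) (use assms in auto)

lemma shifted_le_iff: "enn2ereal g + ereal s \<le> enn2ereal h + ereal s \<longleftrightarrow> g \<le> h"
  by (cases g; cases h) (auto simp: top_unique)

lemma shifted_eq_iff: "enn2ereal g + ereal s = enn2ereal h + ereal s \<longleftrightarrow> g = h"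
  by (auto simp: eq_iff shifted_le_iff)

lemma shifted_le_ereal_iff:
  "enn2ereal g + ereal s \<le> ereal r \<longleftrightarrow> s \<le> r \<and> g \<le> ennreal (r - s)"
proof (cases g)
  case (real q)
  then show ?thesis
    by (cases "s \<le> r") (auto simp: ennreal_le_iff)
qed (auto simp: top_unique)

lemma shifted_eq_infinity_iff: "enn2ereal g + ereal s = \<infinity> \<longleftrightarrow> g = top"
  by (cases g) auto

lemma ereal_eq_shifted:
  assumes "ereal L \<le> c" shows "c = enn2ereal (e2ennreal (c - ereal L)) + ereal L"
proof -
  have "0 \<le> c - ereal L"
    using assms by (cases c) auto
  then show ?thesis
    using assms by (cases c) (auto simp: enn2ereal_e2ennreal)
qed

section \<open>Value iteration for the normalized cost\<close>

locale discounted_mdp =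
  fixes M :: "('x::polish_space, 'a::polish_space) mdp" and \<alpha> L :: real
  assumes mdp: "is_mdp M" and Wstar: "assumption_Wstar M"
    and alpha_nonneg: "0 \<le> \<alpha>" and alpha_less_1: "\<alpha> < 1"
    and cost_bound: "z \<in> Gr M \<Longrightarrow> ereal L \<le> cost M z"
begin

definition ncost :: "'x \<times> 'a \<Rightarrow> ennreal" where
  "ncost z = e2ennreal (cost M z - ereal L)"

text \<open>
  \<open>qval w (x, a)\<close> is the cost of using \<open>a\<close> at \<open>x\<close> and paying the discounted \<open>w\<close> at
  the next state.
\<close>

definition qval :: "('x \<Rightarrow> ennreal) \<Rightarrow> 'x \<times> 'a \<Rightarrow> ennreal" where
  "qval w z = ncost z + ennreal \<alpha> * (\<integral>\<^sup>+y. w y \<partial>kernel M z)"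

primrec value_iter :: "nat \<Rightarrow> 'x \<Rightarrow> ennreal" where
  "value_iter 0 x = 0"
| "value_iter (Suc n) x = (INF a\<in>avail M x. qval (value_iter n) (x, a))"

definition value_lim :: "'x \<Rightarrow> ennreal" where
  "value_lim x = (SUP n. value_iter n x)"

text \<open>
  The amounts by which the normalization \<open>c \<mapsto> c - L\<close> changes the \<open>n\<close>-horizon and the
  infinite-horizon costs.
\<close>

definition shift :: "nat \<Rightarrow> real" where
  "shift n = L * (\<Sum>k<n. \<alpha> ^ k)"

definition shift_lim :: real where
  "shift_lim = L / (1 - \<alpha>)"

lemma cost_eq: "z \<in> Gr M \<Longrightarrow> cost M z = enn2ereal (ncost z) + ereal L"
  unfolding ncost_def by (rule ereal_eq_shifted[OF cost_bound])

lemma shift_Suc: "shift (Suc n) = L + \<alpha> * shift n"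
proof -
  have "(\<Sum>k<Suc n. \<alpha> ^ k) = 1 + \<alpha> * (\<Sum>k<n. \<alpha> ^ k)"
    unfolding sum.lessThan_Suc_shift by (simp add: sum_distrib_left)
  then show ?thesis
    by (simp add: shift_def distrib_left mult.left_commute)
qed

lemma shift_lim_eq: "shift_lim = L + \<alpha> * shift_lim"
  using alpha_less_1 by (simp add: shift_lim_def field_simps)

lemma shift_tendsto: "shift \<longlonglongrightarrow> shift_lim"
proof -
  have "(\<lambda>n. L * (\<Sum>k<n. \<alpha> ^ k)) \<longlonglongrightarrow> L * (1 / (1 - \<alpha>))"
    using geometric_sums[of \<alpha>] alpha_nonneg alpha_less_1
    by (intro tendsto_mult_left) (simp add: sums_def)
  then show ?thesis
    by (simp add: shift_def[abs_def] shift_lim_def)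
qed

lemma GrI: "x \<in> states M \<Longrightarrow> a \<in> avail M x \<Longrightarrow> (x, a) \<in> Gr M"
  by (simp add: Gr_def)

lemma kernel_measurable: "kernel M \<in> borel_on (Gr M) \<rightarrow>\<^sub>M prob_algebra (borel_on (states M))"
  using mdp by (simp add: is_mdp_def)

lemma kernel_in_prob_algebra:
  assumes "z \<in> Gr M"
  shows "kernel M z \<in> space (prob_algebra (borel_on (states M)))"
  by (rule measurable_space[OF kernel_measurable]) (use assms in \<open>simp add: space_restrict_space\<close>)

lemma prob_space_kernel: "z \<in> Gr M \<Longrightarrow> prob_space (kernel M z)"
  using kernel_in_prob_algebra[of z] by (simp add: space_prob_algebra)

lemma sets_kernel: "z \<in> Gr M \<Longrightarrow> sets (kernel M z) = sets (borel_on (states M))"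
  using kernel_in_prob_algebra[of z] by (simp add: space_prob_algebra)

lemma space_kernel: "z \<in> Gr M \<Longrightarrow> space (kernel M z) = states M"
  using sets_eq_imp_space_eq[OF sets_kernel] by (simp add: space_restrict_space)

lemma seq_lsc_ncost: "seq_lsc (Gr M) ncost"
proof (rule seq_lscI_level)
  fix z l and t :: ennreal
  assume z: "\<And>k. z k \<in> Gr M" "l \<in> Gr M" "z \<longlonglongrightarrow> l" and t: "t < top" "\<And>k. ncost (z k) \<le> t"
  then obtain r where r: "t = ennreal r" "0 \<le> r"
    by (cases t) auto
  have level: "ncost y \<le> t \<longleftrightarrow> cost M y \<le> ereal (r + L)" if "y \<in> Gr M" for y
    using r by (simp add: cost_eq[OF that] shifted_le_ereal_iff)
  have "closedin (top_of_set (Gr M)) {y \<in> Gr M. cost M y \<le> ereal (r + L)}"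
    using Wstar by (simp add: assumption_Wstar_def lower_semicont_on_def)
  then obtain C where C: "closed C" "{y \<in> Gr M. cost M y \<le> ereal (r + L)} = Gr M \<inter> C"
    by (auto simp: closedin_closed)
  have "z k \<in> C" for k
    using z(1)[of k] t(2)[of k] C(2) level by blast
  from closed_sequentially[OF C(1) this z(3)] show "ncost l \<le> t"
    using z(2) C(2) level by blast
qed

lemma seq_lsc_qval:
  assumes w: "seq_lsc (states M) w" shows "seq_lsc (Gr M) (qval w)"
proof -
  have "seq_lsc (Gr M) (\<lambda>z. \<integral>\<^sup>+y. w y \<partial>kernel M z)"
  proof (rule seq_lsc_nn_integral[OF w prob_space_kernel sets_kernel])
    fix z z\<^sub>0 and g :: "'x \<Rightarrow> real"
    assume "\<And>k. z k \<in> Gr M" "z\<^sub>0 \<in> Gr M" "z \<longlonglongrightarrow> z\<^sub>0" "continuous_on (states M) g" "bounded (g ` states M)"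
    then show "(\<lambda>k. \<integral>y. g y \<partial>kernel M (z k)) \<longlonglongrightarrow> (\<integral>y. g y \<partial>kernel M z\<^sub>0)"
      using Wstar unfolding assumption_Wstar_def weakly_continuous_kernel_def by blast
  qed
  then show ?thesis
    unfolding qval_def[abs_def] by (intro seq_lsc_add seq_lsc_cmult seq_lsc_ncost)
qed

lemma inf_compact_ncost: "sequentially_inf_compact (states M) (avail M) ncost"
  unfolding sequentially_inf_compact_def
proof (intro allI impI)
  fix x l a and t :: ennreal
  assume *: "\<forall>n. x n \<in> states M" "l \<in> states M" "x \<longlonglongrightarrow> l" "\<forall>n. a n \<in> avail M (x n)"
    "t < top" "\<forall>n. ncost (x n, a n) \<le> t"
  then obtain r where r: "t = ennreal r" "0 \<le> r"
    by (cases t) auto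
  have "cost M (x n, a n) \<le> ereal (r + L)" for n
    using * r by (simp add: cost_eq[OF GrI] shifted_le_ereal_iff)
  then show "\<exists>b\<in>avail M l. \<exists>r. strict_mono r \<and> (a \<circ> r) \<longlonglongrightarrow> b"
    using * Wstar unfolding assumption_Wstar_def by blast
qed

lemma ncost_le_qval: "ncost z \<le> qval w z"
  by (simp add: qval_def)

lemma inf_compact_qval: "sequentially_inf_compact (states M) (avail M) (qval w)"
  by (rule sequentially_inf_compact_mono[OF inf_compact_ncost ncost_le_qval])

lemma seq_lsc_value_iter: "seq_lsc (states M) (value_iter n)"
proof (induction n)
  case 0
  then show ?case by (simp add: seq_lsc_def)
next
  case (Suc n)
  have "seq_lsc (states M) (\<lambda>x. INF a\<in>avail M x. qval (value_iter n) (x, a))"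
    by (rule seq_lsc_min[OF _ inf_compact_qval]) (use seq_lsc_qval[OF Suc] in \<open>simp add: Gr_def\<close>)
  then show ?case by (simp cong: seq_lsc_cong)
qed

lemma seq_lsc_value_lim: "seq_lsc (states M) value_lim"
  unfolding value_lim_def[abs_def] by (rule seq_lsc_SUP[OF seq_lsc_value_iter])

lemma measurable_value_iter: "value_iter n \<in> borel_measurable (borel_on (states M))"
  by (rule borel_measurable_seq_lsc[OF seq_lsc_value_iter])

lemma measurable_value_lim: "value_lim \<in> borel_measurable (borel_on (states M))"
  by (rule borel_measurable_seq_lsc[OF seq_lsc_value_lim])

lemma measurable_ncost: "ncost \<in> borel_measurable (borel_on (Gr M))"
  by (rule borel_measurable_seq_lsc[OF seq_lsc_ncost])

lemma measurable_kernel_integral: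
  assumes w: "w \<in> borel_measurable (borel_on (states M))"
  shows "(\<lambda>z. \<integral>\<^sup>+y. w y \<partial>kernel M z) \<in> borel_measurable (borel_on (Gr M))"
  by (rule measurable_compose[OF measurable_prob_algebraD[OF kernel_measurable]
        nn_integral_measurable_subprob_algebra[OF w]])

lemma measurable_qval:
  assumes w: "w \<in> borel_measurable (borel_on (states M))"
  shows "qval w \<in> borel_measurable (borel_on (Gr M))"
proof -
  note [measurable] = measurable_ncost measurable_kernel_integral[OF w]
  show ?thesis
    unfolding qval_def[abs_def] by measurable
qed

lemma qval_mono:
  assumes "z \<in> Gr M" "\<And>y. y \<in> states M \<Longrightarrow> w y \<le> w' y" shows "qval w z \<le> qval w' z"
  unfolding qval_def
  by (intro add_left_mono mult_left_mono nn_integral_mono) (use assms in \<open>auto simp: space_kernel\<close>)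

lemma qval_cong:
  assumes "z \<in> Gr M" "\<And>y. y \<in> states M \<Longrightarrow> w y = w' y" shows "qval w z = qval w' z"
  by (intro antisym qval_mono) (use assms in auto)

lemma qval_SUP:
  assumes z: "z \<in> Gr M" and w: "\<And>n. w n \<in> borel_measurable (borel_on (states M))"
    and mono: "\<And>n y. y \<in> states M \<Longrightarrow> w n y \<le> w (Suc n) y"
  shows "qval (\<lambda>y. SUP n. w n y) z = (SUP n. qval (w n) z)"
proof -
  have "(\<integral>\<^sup>+y. (SUP n. w n y) \<partial>kernel M z) = (SUP n. \<integral>\<^sup>+y. w n y \<partial>kernel M z)"
  proof (rule nn_integral_monotone_convergence_SUP_AE)
    show "AE y in kernel M z. w n y \<le> w (Suc n) y" for n
      by (rule AE_I2) (simp add: space_kernel[OF z] mono)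
    show "w n \<in> borel_measurable (kernel M z)" for n
      using w by (simp add: measurable_cong_sets[OF sets_kernel[OF z] refl])
  qed
  then show ?thesis
    unfolding qval_def by (simp add: SUP_mult_left_ennreal ennreal_SUP_add_right)
qed

lemma value_iter_mono_Suc: "x \<in> states M \<Longrightarrow> value_iter n x \<le> value_iter (Suc n) x"
proof (induction n arbitrary: x)
  case (Suc n)
  have "qval (value_iter n) (x, a) \<le> qval (value_iter (Suc n)) (x, a)" if "a \<in> avail M x" for a
    by (intro qval_mono GrI Suc.prems Suc.IH that)
  then have "(INF a\<in>avail M x. qval (value_iter n) (x, a)) \<le> (INF a\<in>avail M x. qval (value_iter (Suc n)) (x, a))"
    by (intro INF_mono) blast
  then show ?case
    by (simp only: value_iter.simps(2))
qed simp

lemma incseq_value_iter: "x \<in> states M \<Longrightarrow> incseq (\<lambda>n. value_iter n x)"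
  by (rule incseq_SucI) (rule value_iter_mono_Suc)

lemma avail_nonempty: "x \<in> states M \<Longrightarrow> avail M x \<noteq> {}"
  using mdp by (simp add: is_mdp_def)

lemma value_iter_attained:
  assumes "x \<in> states M" shows "\<exists>a\<in>avail M x. qval (value_iter n) (x, a) = value_iter (Suc n) x"
  unfolding value_iter.simps
  by (rule min_attained[OF _ inf_compact_qval assms avail_nonempty[OF assms]])
     (use seq_lsc_qval[OF seq_lsc_value_iter] in \<open>simp add: Gr_def\<close>)

lemma qval_value_lim: "z \<in> Gr M \<Longrightarrow> qval value_lim z = (SUP n. qval (value_iter n) z)"
  unfolding value_lim_def[abs_def] by (rule qval_SUP[where w=value_iter, OF _ measurable_value_iter value_iter_mono_Suc])

text \<open>
  The inequality \<open>\<ge>\<close> rests on compactness.  Let \<open>a\<^sub>n\<close> minimize \<open>qval (value_iter n) (x, \<cdot>)\<close>.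
  If \<open>value_lim x\<close> is finite, then the costs of the \<open>a\<^sub>n\<close> are bounded and a subsequence converges to
  some \<open>b\<close>.  For fixed \<open>m\<close> and \<open>n \<ge> m\<close> monotonicity gives
  \<open>qval (value_iter m) (x, a\<^sub>n) \<le> value_lim x\<close>, by lower semicontinuity the same bound holds at \<open>b\<close>, and
  \<open>m \<rightarrow> \<infinity>\<close> yields \<open>qval value_lim (x, b) \<le> value_lim x\<close>.
\<close>

lemma bellman_value_lim:
  assumes x: "x \<in> states M"
  shows "value_lim x = (INF a\<in>avail M x. qval value_lim (x, a))"
proof (rule antisym)
  show "value_lim x \<le> (INF a\<in>avail M x. qval value_lim (x, a))"
  proof (rule INF_greatest)
    fix a assume a: "a \<in> avail M x"
    show "value_lim x \<le> qval value_lim (x, a)"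
      unfolding value_lim_def[of x]
    proof (rule SUP_least)
      fix n
      have "value_iter n x \<le> value_iter (Suc n) x"
        by (rule value_iter_mono_Suc[OF x])
      also have "\<dots> \<le> qval (value_iter n) (x, a)"
        using a by (auto intro: INF_lower)
      also have "\<dots> \<le> qval value_lim (x, a)"
        by (rule qval_mono[OF GrI[OF x a]]) (auto simp: value_lim_def intro: SUP_upper)
      finally show "value_iter n x \<le> qval value_lim (x, a)" .
    qed
  qed
  show "(INF a\<in>avail M x. qval value_lim (x, a)) \<le> value_lim x"
  proof (cases "value_lim x < top")
    case False
    then have "value_lim x = top"
      using top.not_eq_extremum by blast
    then show ?thesis by simp
  next
    case True
    obtain a where a: "\<And>n. a n \<in> avail M x" "\<And>n. qval (value_iter n) (x, a n) = value_iter (Suc n) x"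
      using value_iter_attained[OF x] by metis
    have le: "qval (value_iter n) (x, a n) \<le> value_lim x" for n
      unfolding a value_lim_def by (rule SUP_upper) simp
    obtain b r where b: "b \<in> avail M x" and r: "strict_mono (r :: nat \<Rightarrow> nat)" "(a \<circ> r) \<longlonglongrightarrow> b"
      using inf_compact_ncost[unfolded sequentially_inf_compact_def, rule_format, of "\<lambda>_. x" x a "value_lim x"]
        x a(1) True order_trans[OF ncost_le_qval le] by auto
    have "qval (value_iter m) (x, b) \<le> value_lim x" for m
    proof -
      have "qval (value_iter m) (x, b) \<le> liminf (\<lambda>k. qval (value_iter m) (x, a (r k)))"
        by (rule seq_lscD[OF seq_lsc_qval[OF seq_lsc_value_iter], where z="\<lambda>k. (x, a (r k))"])
           (use GrI[OF x] a(1) b r(2) in \<open>auto intro!: tendsto_Pair simp: comp_def\<close>)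
      also have "\<dots> \<le> liminf (\<lambda>k. value_lim x)"
      proof (rule Liminf_mono, rule eventually_sequentiallyI[of m])
        fix k assume "m \<le> k"
        also have "k \<le> r k"
          using r(1) by (rule strict_mono_imp_increasing)
        finally have "m \<le> r k" .
        have "qval (value_iter m) (x, a (r k)) \<le> qval (value_iter (r k)) (x, a (r k))"
          using incseqD[OF incseq_value_iter \<open>m \<le> r k\<close>] by (intro qval_mono GrI x a)
        also note le
        finally show "qval (value_iter m) (x, a (r k)) \<le> value_lim x" .
      qed
      finally show ?thesis
        by (simp add: Liminf_const)
    qed
    then have "qval value_lim (x, b) \<le> value_lim x"
      unfolding qval_value_lim[OF GrI[OF x b]] by (rule SUP_least)
    with b show ?thesis
      by (rule INF_lower2)
  qed
qed

lemma value_lim_attained: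
  assumes "x \<in> states M" shows "\<exists>a\<in>avail M x. qval value_lim (x, a) = value_lim x"
  unfolding bellman_value_lim[OF assms]
  by (rule min_attained[OF _ inf_compact_qval assms avail_nonempty[OF assms]])
     (use seq_lsc_qval[OF seq_lsc_value_lim] in \<open>simp add: Gr_def\<close>)

lemma states_borel: "states M \<in> sets borel"
  using mdp by (simp add: is_mdp_def)

lemma avail_actions: "x \<in> states M \<Longrightarrow> avail M x \<subseteq> actions M"
  using mdp by (simp add: is_mdp_def)

lemma greedy_selector:
  assumes w: "seq_lsc (states M) w"
  shows "\<exists>\<phi>. selector M \<phi> \<and> (\<forall>x\<in>states M. qval w (x, \<phi> x) = (INF a\<in>avail M x. qval w (x, a)))"
proof -
  obtain \<phi>\<^sub>0 where \<phi>\<^sub>0: "selector M \<phi>\<^sub>0"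
    using mdp by (auto simp: is_mdp_def)
  have id: "(\<lambda>a. a) \<in> borel_on (actions M) \<rightarrow>\<^sub>M borel"
    by (rule measurable_restrict_space1[OF measurable_ident_sets[OF refl]])
  have "\<exists>\<phi>\<in>borel_on (states M) \<rightarrow>\<^sub>M borel. \<forall>x\<in>states M. \<phi> x \<in> avail M x \<and>
      qval w (x, \<phi> x) = (INF a\<in>avail M x. qval w (x, a))"
  proof (rule measurable_argmin_selection[OF _ inf_compact_qval states_borel])
    show "seq_lsc (Sigma (states M) (avail M)) (qval w)"
      using seq_lsc_qval[OF w] by (simp add: Gr_def)
    show "\<phi>\<^sub>0 \<in> borel_on (states M) \<rightarrow>\<^sub>M borel"
      using \<phi>\<^sub>0 measurable_compose[OF _ id] by (auto simp: selector_def)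
  qed (use \<phi>\<^sub>0 in \<open>auto simp: selector_def\<close>)
  then obtain \<phi> where \<phi>: "\<phi> \<in> borel_on (states M) \<rightarrow>\<^sub>M borel"
    "\<And>x. x \<in> states M \<Longrightarrow> \<phi> x \<in> avail M x"
    "\<And>x. x \<in> states M \<Longrightarrow> qval w (x, \<phi> x) = (INF a\<in>avail M x. qval w (x, a))"
    by auto
  have "\<phi> \<in> borel_on (states M) \<rightarrow>\<^sub>M borel_on (actions M)"
    by (rule measurable_restrict_space2[OF _ \<phi>(1)])
       (use \<phi>(2) avail_actions in \<open>auto simp: space_restrict_space\<close>)
  with \<phi> show ?thesis
    by (auto simp: selector_def)
qed

lemma selector_avail: "selector M \<phi> \<Longrightarrow> x \<in> states M \<Longrightarrow> \<phi> x \<in> avail M x"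
  by (simp add: selector_def)

lemma selector_graph_measurable:
  assumes \<phi>: "selector M \<phi>"
  shows "(\<lambda>x. (x, \<phi> x)) \<in> borel_on (states M) \<rightarrow>\<^sub>M borel_on (Gr M)"
proof -
  have "(\<lambda>x. (x, \<phi> x)) \<in> borel_on (states M) \<rightarrow>\<^sub>M step_space M"
    using \<phi> by (intro measurable_Pair measurable_ident_sets[OF refl]) (simp_all add: selector_def)
  then have "(\<lambda>x. (x, \<phi> x)) \<in> borel_on (states M) \<rightarrow>\<^sub>M restrict_space (step_space M) (Gr M)"
    by (rule measurable_restrict_space2[rotated])
       (use GrI selector_avail[OF \<phi>] in \<open>auto simp: space_restrict_space\<close>)
  then show ?thesis
    unfolding measurable_cong_sets[OF refl restrict_step_space_Gr[OF mdp]] .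
qed

end

section \<open>Expected costs of policies and optimality of greedy policies\<close>

context discounted_mdp
begin

definition policy_ncost :: "nat \<Rightarrow> ('x, 'a) policy \<Rightarrow> 'x \<Rightarrow> ennreal" where
  "policy_ncost N \<pi> x = (\<Sum>n<N. ennreal (\<alpha> ^ n) * (\<integral>\<^sup>+\<omega>. ncost (\<omega> n) \<partial>traj_measure M \<pi> x))"

lemma policy_ncost_0 [simp]: "policy_ncost 0 \<pi> x = 0"
  by (simp add: policy_ncost_def)

lemma policy_ncost_Suc:
  "policy_ncost (Suc N) \<pi> x =
    policy_ncost N \<pi> x + ennreal (\<alpha> ^ N) * (\<integral>\<^sup>+\<omega>. ncost (\<omega> N) \<partial>traj_measure M \<pi> x)"
  by (simp add: policy_ncost_def)

lemma policy_ncost_mono: "N \<le> N' \<Longrightarrow> policy_ncost N \<pi> x \<le> policy_ncost N' \<pi> x"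
  unfolding policy_ncost_def by (rule sum_mono2) auto

lemma sum_cost_eq:
  assumes "\<And>n. \<omega> n \<in> Gr M"
  shows "(\<Sum>n<N. ereal (\<alpha> ^ n) * cost M (\<omega> n)) =
    enn2ereal (\<Sum>n<N. ennreal (\<alpha> ^ n) * ncost (\<omega> n)) + ereal (shift N)"
proof (induction N)
  case 0
  then show ?case by (simp add: shift_def zero_ennreal.rep_eq zero_ereal_def)
next
  case (Suc N)
  have "ereal (\<alpha> ^ N) * cost M (\<omega> N) = enn2ereal (ennreal (\<alpha> ^ N) * ncost (\<omega> N)) + ereal (\<alpha> ^ N * L)"
    using alpha_nonneg by (simp add: cost_eq[OF assms] ereal_mult_shifted)
  moreover have "shift (Suc N) = shift N + \<alpha> ^ N * L"
    by (simp add: shift_def algebra_simps)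
  ultimately show ?case
    unfolding sum.lessThan_Suc Suc.IH
    by (simp add: enn2ereal_add ac_simps flip: plus_ereal.simps(1))
qed

context
  fixes \<pi> :: "('x, 'a) policy" and x :: 'x
  assumes pol: "is_policy M \<pi>" and x: "x \<in> states M"
begin

lemmas AE_graph = AE_in_graph[OF mdp pol x]

lemma measurable_graph_cost:
  assumes h: "h \<in> borel_measurable (borel_on (Gr M))"
  shows "(\<lambda>\<omega>. h (\<omega> n) * indicator (Gr M) (\<omega> n) :: ennreal) \<in> borel_measurable (traj_measure M \<pi> x)"
  by (rule measurable_compose[OF measurable_coordinate[OF mdp pol x] measurable_on_graph[OF mdp h]])

lemma AE_graph_cost: "AE \<omega> in traj_measure M \<pi> x. h (\<omega> n) = h (\<omega> n) * (indicator (Gr M) (\<omega> n) :: ennreal)"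
  using AE_graph[of n] by eventually_elim simp

text \<open>
  The conditional law of the next state given the current step is the kernel, so the kernel
  integral in \<open>qval\<close> may be replaced by the value of \<open>w\<close> at the next state.
\<close>

lemma expected_qval:
  assumes w: "w \<in> borel_measurable (borel_on (states M))"
  shows "(\<integral>\<^sup>+\<omega>. qval w (\<omega> n) \<partial>traj_measure M \<pi> x) =
    (\<integral>\<^sup>+\<omega>. ncost (\<omega> n) \<partial>traj_measure M \<pi> x) + ennreal \<alpha> * (\<integral>\<^sup>+\<omega>. w (fst (\<omega> (Suc n))) \<partial>traj_measure M \<pi> x)"
proof -
  let ?i = "\<lambda>\<omega>. indicator (Gr M) (\<omega> n) :: ennreal"
  let ?k = "\<lambda>z. \<integral>\<^sup>+y. w y \<partial>kernel M z"
  note [measurable] = measurable_graph_cost[OF measurable_ncost, of n]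
    measurable_graph_cost[OF measurable_kernel_integral[OF w], of n]
  have "(\<integral>\<^sup>+\<omega>. qval w (\<omega> n) \<partial>traj_measure M \<pi> x) = (\<integral>\<^sup>+\<omega>. ncost (\<omega> n) * ?i \<omega> + ennreal \<alpha> * (?k (\<omega> n) * ?i \<omega>) \<partial>traj_measure M \<pi> x)"
    by (rule nn_integral_cong_AE, use AE_graph[of n] in eventually_elim) (simp add: qval_def)
  also have "\<dots> = (\<integral>\<^sup>+\<omega>. ncost (\<omega> n) * ?i \<omega> \<partial>traj_measure M \<pi> x) + ennreal \<alpha> * (\<integral>\<^sup>+\<omega>. ?k (\<omega> n) * ?i \<omega> \<partial>traj_measure M \<pi> x)"
    by (subst nn_integral_add) (auto simp: nn_integral_cmult)
  also have "\<dots> = (\<integral>\<^sup>+\<omega>. ncost (\<omega> n) \<partial>traj_measure M \<pi> x) + ennreal \<alpha> * (\<integral>\<^sup>+\<omega>. ?k (\<omega> n) \<partial>traj_measure M \<pi> x)"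
    using nn_integral_cong_AE[OF AE_graph_cost[of ncost n]] nn_integral_cong_AE[OF AE_graph_cost[of ?k n]] by simp
  finally show ?thesis
    by (simp add: nn_integral_next_state[OF mdp pol x w])
qed

lemma telescope_step:
  assumes w: "w \<in> borel_measurable (borel_on (states M))"
  shows "policy_ncost n \<pi> x + ennreal (\<alpha> ^ n) * (\<integral>\<^sup>+\<omega>. qval w (\<omega> n) \<partial>traj_measure M \<pi> x) =
    policy_ncost (Suc n) \<pi> x + ennreal (\<alpha> ^ Suc n) * (\<integral>\<^sup>+\<omega>. w (fst (\<omega> (Suc n))) \<partial>traj_measure M \<pi> x)"
  by (simp add: expected_qval[OF w] policy_ncost_Suc distrib_left ennreal_mult alpha_nonneg ac_simps)

lemma telescope_le:
  assumes w: "\<And>n. w n \<in> borel_measurable (borel_on (states M))"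
    and le: "\<And>n z. n < N \<Longrightarrow> z \<in> Gr M \<Longrightarrow> w n (fst z) \<le> qval (w (Suc n)) z"
  shows "n \<le> N \<Longrightarrow> w 0 x \<le> policy_ncost n \<pi> x + ennreal (\<alpha> ^ n) * (\<integral>\<^sup>+\<omega>. w n (fst (\<omega> n)) \<partial>traj_measure M \<pi> x)"
proof (induction n)
  case 0
  show ?case
    by (simp add: nn_integral_initial_state[OF mdp pol x w])
next
  case (Suc n)
  have "(\<integral>\<^sup>+\<omega>. w n (fst (\<omega> n)) \<partial>traj_measure M \<pi> x) \<le> (\<integral>\<^sup>+\<omega>. qval (w (Suc n)) (\<omega> n) \<partial>traj_measure M \<pi> x)"
    by (rule nn_integral_mono_AE, use AE_graph[of n] in eventually_elim)
       (use Suc.prems in \<open>simp add: le\<close>)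
  then have "policy_ncost n \<pi> x + ennreal (\<alpha> ^ n) * (\<integral>\<^sup>+\<omega>. w n (fst (\<omega> n)) \<partial>traj_measure M \<pi> x) \<le>
      policy_ncost n \<pi> x + ennreal (\<alpha> ^ n) * (\<integral>\<^sup>+\<omega>. qval (w (Suc n)) (\<omega> n) \<partial>traj_measure M \<pi> x)"
    by (intro add_left_mono mult_left_mono) auto
  with Suc show ?case
    unfolding telescope_step[OF w] by simp
qed

lemma policy_cost_fin_eq: "policy_cost_fin M \<alpha> N \<pi> x = enn2ereal (policy_ncost N \<pi> x) + ereal (shift N)"
proof -
  let ?g = "\<lambda>\<omega>. \<Sum>n<N. ennreal (\<alpha> ^ n) * (ncost (\<omega> n) * indicator (Gr M) (\<omega> n))"
  note [measurable] = measurable_graph_cost[OF measurable_ncost]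
  have "AE \<omega> in traj_measure M \<pi> x. \<forall>n. \<omega> n \<in> Gr M"
    by (simp add: AE_all_countable AE_graph)
  then have "AE \<omega> in traj_measure M \<pi> x. (\<Sum>n<N. ereal (\<alpha> ^ n) * cost M (\<omega> n)) = enn2ereal (?g \<omega>) + ereal (shift N)"
    by eventually_elim (simp add: sum_cost_eq)
  then have "policy_cost_fin M \<alpha> N \<pi> x = enn2ereal (\<integral>\<^sup>+\<omega>. ?g \<omega> \<partial>traj_measure M \<pi> x) + ereal (shift N)"
    unfolding policy_cost_fin_def by (intro eintegral_shifted prob_space_traj[OF mdp pol x]) measurable
  also have "(\<integral>\<^sup>+\<omega>. ?g \<omega> \<partial>traj_measure M \<pi> x) = policy_ncost N \<pi> x"
    unfolding policy_ncost_def
    by (subst nn_integral_sum)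
       (auto simp: nn_integral_cmult nn_integral_cong_AE[OF AE_graph_cost[of ncost]])
  finally show ?thesis .
qed

text \<open>
  The partial sums of the original costs are shifted partial sums of the normalized ones, and the
  series follows by passing to the limit; the nonnegative series is then integrated term by term.
\<close>

lemma policy_cost_eq:
  "policy_cost M \<alpha> \<pi> x = enn2ereal (SUP N. policy_ncost N \<pi> x) + ereal shift_lim"
proof -
  let ?g = "\<lambda>\<omega>. \<Sum>n. ennreal (\<alpha> ^ n) * (ncost (\<omega> n) * indicator (Gr M) (\<omega> n))"
  note [measurable] = measurable_graph_cost[OF measurable_ncost]
  have "AE \<omega> in traj_measure M \<pi> x. \<forall>n. \<omega> n \<in> Gr M"
    by (simp add: AE_all_countable AE_graph)
  then have "AE \<omega> in traj_measure M \<pi> x. (\<Sum>n. ereal (\<alpha> ^ n) * cost M (\<omega> n)) = enn2ereal (?g \<omega>) + ereal shift_lim"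
  proof eventually_elim
    case (elim \<omega>)
    have "(\<lambda>N. enn2ereal (\<Sum>n<N. ennreal (\<alpha> ^ n) * ncost (\<omega> n)) + ereal (shift N))
        \<longlonglongrightarrow> enn2ereal (\<Sum>n. ennreal (\<alpha> ^ n) * ncost (\<omega> n)) + ereal shift_lim"
      by (intro tendsto_shifted shift_tendsto summable_LIMSEQ) simp
    then have "(\<lambda>n. ereal (\<alpha> ^ n) * cost M (\<omega> n)) sums
        (enn2ereal (\<Sum>n. ennreal (\<alpha> ^ n) * ncost (\<omega> n)) + ereal shift_lim)"
      unfolding sums_def using elim by (simp add: sum_cost_eq)
    with elim show ?case
      by (simp add: sums_unique[symmetric])
  qed
  then have "policy_cost M \<alpha> \<pi> x = enn2ereal (\<integral>\<^sup>+\<omega>. ?g \<omega> \<partial>traj_measure M \<pi> x) + ereal shift_lim"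
    unfolding policy_cost_def by (intro eintegral_shifted prob_space_traj[OF mdp pol x]) measurable
  also have "(\<integral>\<^sup>+\<omega>. ?g \<omega> \<partial>traj_measure M \<pi> x) = (\<Sum>n. ennreal (\<alpha> ^ n) * (\<integral>\<^sup>+\<omega>. ncost (\<omega> n) \<partial>traj_measure M \<pi> x))"
    by (subst nn_integral_suminf)
       (auto simp: nn_integral_cmult nn_integral_cong_AE[OF AE_graph_cost[of ncost]])
  also have "\<dots> = (SUP N. policy_ncost N \<pi> x)"
    unfolding policy_ncost_def by (rule suminf_eq_SUP)
  finally show ?thesis .
qed

text \<open>
  Telescoping with \<open>N - n\<close> iterations left at time \<open>n\<close>, so that the tail
  \<open>value_iter 0 = 0\<close> vanishes at time \<open>N\<close>.
\<close>

lemma value_iter_le_policy_ncost: "value_iter N x \<le> policy_ncost N \<pi> x"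
proof -
  \<comment> \<open>The differences \<open>N - 0\<close> and \<open>N - N\<close> make the first and the last iterate instances of
    one time-indexed sequence.\<close>
  have "value_iter (N - 0) x \<le> policy_ncost N \<pi> x + ennreal (\<alpha> ^ N) * (\<integral>\<^sup>+\<omega>. value_iter (N - N) (fst (\<omega> N)) \<partial>traj_measure M \<pi> x)"
  proof (rule telescope_le[where w="\<lambda>n. value_iter (N - n)" and N=N])
    fix n z assume n: "n < N" and z: "z \<in> Gr M"
    have "value_iter (Suc (N - Suc n)) (fst z) \<le> qval (value_iter (N - Suc n)) (fst z, snd z)"
      using z by (auto simp: Gr_def intro: INF_lower)
    then show "value_iter (N - n) (fst z) \<le> qval (value_iter (N - Suc n)) z"
      using n by (simp only: Suc_diff_Suc prod.collapse)
  qed (auto intro: measurable_value_iter)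
  then show ?thesis by simp
qed

end

text \<open>
  Under a Markov policy the action is almost surely \<open>\<phi> n\<close> of the state, so a one-step equation
  along \<open>\<phi>\<close> is enough to make the telescoped relation an equation.
\<close>

lemma telescope_markov:
  assumes \<phi>: "\<And>n. selector M (\<phi> n)" and x: "x \<in> states M"
    and w: "\<And>n. w n \<in> borel_measurable (borel_on (states M))"
    and eq: "\<And>n y. n < N \<Longrightarrow> y \<in> states M \<Longrightarrow> w n y = qval (w (Suc n)) (y, \<phi> n y)"
  shows "n \<le> N \<Longrightarrow> w 0 x = policy_ncost n (markov M \<phi>) x +
    ennreal (\<alpha> ^ n) * (\<integral>\<^sup>+\<omega>. w n (fst (\<omega> n)) \<partial>traj_measure M (markov M \<phi>) x)"
proof (induction n)
  note pol = is_policy_markov[OF mdp \<phi>]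
  case 0
  show ?case
    by (simp add: nn_integral_initial_state[OF mdp pol x w])
next
  note pol = is_policy_markov[OF mdp \<phi>]
  case (Suc n)
  let ?T = "traj_measure M (markov M \<phi>) x"
  have "(\<integral>\<^sup>+\<omega>. w n (fst (\<omega> n)) \<partial>?T) = (\<integral>\<^sup>+\<omega>. qval (w (Suc n)) (\<omega> n) \<partial>?T)"
  proof (rule nn_integral_cong_AE, use AE_in_graph[OF mdp pol x, of n] AE_markov_action[OF mdp \<phi> x, of n] in eventually_elim)
    case (elim \<omega>)
    then have "fst (\<omega> n) \<in> states M" "(fst (\<omega> n), \<phi> n (fst (\<omega> n))) = \<omega> n"
      by (auto simp: Gr_def prod_eq_iff)
    then show ?case
      using Suc.prems eq[of n "fst (\<omega> n)"] by simp
  qed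
  with Suc show ?case
    using telescope_step[OF pol x w[of "Suc n"], of n] by simp
qed

lemma greedy_horizon:
  assumes \<phi>: "\<And>n. selector M (\<phi> n)" and x: "x \<in> states M"
    and greedy: "\<And>n y. n < N \<Longrightarrow> y \<in> states M \<Longrightarrow> qval (value_iter n) (y, \<phi> (N - 1 - n) y) = value_iter (Suc n) y"
  shows "policy_ncost N (markov M \<phi>) x = value_iter N x"
proof -
  have "value_iter (N - 0) x = policy_ncost N (markov M \<phi>) x +
      ennreal (\<alpha> ^ N) * (\<integral>\<^sup>+\<omega>. value_iter (N - N) (fst (\<omega> N)) \<partial>traj_measure M (markov M \<phi>) x)"
  proof (rule telescope_markov[OF \<phi> x, where w="\<lambda>n. value_iter (N - n)" and N=N])
    fix n y assume n: "n < N" and y: "y \<in> states M"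
    have "N - 1 - (N - Suc n) = n" "Suc (N - Suc n) = N - n"
      using n by auto
    then show "value_iter (N - n) y = qval (value_iter (N - Suc n)) (y, \<phi> n y)"
      using greedy[of "N - Suc n" y] n y by (simp del: value_iter.simps)
  qed (auto intro: measurable_value_iter)
  then show ?thesis by simp
qed

lemma greedy_markov_exists:
  "\<exists>\<phi>. (\<forall>n. selector M (\<phi> n)) \<and>
     (\<forall>n<N. \<forall>y\<in>states M. qval (value_iter n) (y, \<phi> (N - 1 - n) y) = value_iter (Suc n) y)"
proof -
  obtain \<psi> where \<psi>: "\<And>n. selector M (\<psi> n)"
    "\<And>n y. y \<in> states M \<Longrightarrow> qval (value_iter n) (y, \<psi> n y) = value_iter (Suc n) y"
    using greedy_selector[OF seq_lsc_value_iter] unfolding value_iter.simps by metis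
  have "N - 1 - (N - 1 - n) = n" if "n < N" for n
    using that by simp
  with \<psi> show ?thesis
    by (intro exI[of _ "\<lambda>m. \<psi> (N - 1 - m)"]) (auto simp del: value_iter.simps)
qed

lemma value_fin_eq:
  assumes x: "x \<in> states M"
  shows "value_fin M \<alpha> N x = enn2ereal (value_iter N x) + ereal (shift N)"
  unfolding value_fin_def
proof (rule antisym)
  obtain \<phi> where \<phi>: "\<And>n. selector M (\<phi> n)"
    and greedy: "\<And>n y. n < N \<Longrightarrow> y \<in> states M \<Longrightarrow> qval (value_iter n) (y, \<phi> (N - 1 - n) y) = value_iter (Suc n) y"
    using greedy_markov_exists[of N] by (auto simp del: value_iter.simps)
  have "policy_cost_fin M \<alpha> N (markov M \<phi>) x = enn2ereal (value_iter N x) + ereal (shift N)"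
    by (simp only: policy_cost_fin_eq[OF is_policy_markov[OF mdp \<phi>] x] greedy_horizon[OF \<phi> x greedy])
  then show "(INF \<pi>\<in>{\<pi>. is_policy M \<pi>}. policy_cost_fin M \<alpha> N \<pi> x) \<le> enn2ereal (value_iter N x) + ereal (shift N)"
    by (intro INF_lower2[of "markov M \<phi>"]) (use is_policy_markov[OF mdp \<phi>] in auto)
  show "enn2ereal (value_iter N x) + ereal (shift N) \<le> (INF \<pi>\<in>{\<pi>. is_policy M \<pi>}. policy_cost_fin M \<alpha> N \<pi> x)"
    by (rule INF_greatest) (simp add: policy_cost_fin_eq x shifted_le_iff value_iter_le_policy_ncost)
qed

text \<open>
  Telescoping with the constant sequence \<open>value_lim\<close> leaves a nonnegative tail, which is
  dropped.
\<close>

lemma greedy_stationary: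
  assumes \<phi>: "selector M \<phi>" and x: "x \<in> states M"
    and greedy: "\<And>y. y \<in> states M \<Longrightarrow> qval value_lim (y, \<phi> y) = value_lim y"
  shows "(SUP N. policy_ncost N (stationary M \<phi>) x) \<le> value_lim x"
proof (rule SUP_least)
  fix N
  have "value_lim x = policy_ncost N (stationary M \<phi>) x +
      ennreal (\<alpha> ^ N) * (\<integral>\<^sup>+\<omega>. value_lim (fst (\<omega> N)) \<partial>traj_measure M (stationary M \<phi>) x)"
    by (rule telescope_markov[where w="\<lambda>_. value_lim" and N=N]) (use \<phi> x greedy measurable_value_lim in auto)
  then show "policy_ncost N (stationary M \<phi>) x \<le> value_lim x"
    by simp
qed

lemma value_lim_le_policy_ncost:
  assumes "is_policy M \<pi>" "x \<in> states M"
  shows "value_lim x \<le> (SUP N. policy_ncost N \<pi> x)"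
  unfolding value_lim_def by (intro SUP_mono' value_iter_le_policy_ncost assms)

lemma is_policy_stationary: "selector M \<phi> \<Longrightarrow> is_policy M (stationary M \<phi>)"
  by (rule is_policy_markov[OF mdp])

lemma greedy_stationary_exists:
  "\<exists>\<phi>. selector M \<phi> \<and> (\<forall>y\<in>states M. qval value_lim (y, \<phi> y) = value_lim y)"
  using greedy_selector[OF seq_lsc_value_lim] by (metis bellman_value_lim)

lemma greedy_stationary_cost:
  assumes "selector M \<phi>" "x \<in> states M" "\<And>y. y \<in> states M \<Longrightarrow> qval value_lim (y, \<phi> y) = value_lim y"
  shows "policy_cost M \<alpha> (stationary M \<phi>) x = enn2ereal (value_lim x) + ereal shift_lim"
  unfolding policy_cost_eq[OF is_policy_stationary[OF assms(1)] assms(2)] shifted_eq_iff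
  by (intro antisym greedy_stationary value_lim_le_policy_ncost is_policy_stationary assms)

lemma value_inf_eq:
  assumes x: "x \<in> states M"
  shows "value_inf M \<alpha> x = enn2ereal (value_lim x) + ereal shift_lim"
  unfolding value_inf_def
proof (rule antisym)
  obtain \<phi> where \<phi>: "selector M \<phi>" "\<And>y. y \<in> states M \<Longrightarrow> qval value_lim (y, \<phi> y) = value_lim y"
    using greedy_stationary_exists by auto
  show "(INF \<pi>\<in>{\<pi>. is_policy M \<pi>}. policy_cost M \<alpha> \<pi> x) \<le> enn2ereal (value_lim x) + ereal shift_lim"
    by (rule INF_lower2[of "stationary M \<phi>"])
       (simp_all add: is_policy_stationary \<phi> greedy_stationary_cost x)
  show "enn2ereal (value_lim x) + ereal shift_lim \<le> (INF \<pi>\<in>{\<pi>. is_policy M \<pi>}. policy_cost M \<alpha> \<pi> x)"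
    by (rule INF_greatest) (simp add: policy_cost_eq x shifted_le_iff value_lim_le_policy_ncost)
qed

text \<open>
  Value iteration with the minimization replaced by the action \<open>\<phi> y\<close>; it computes the
  finite-horizon costs of the stationary policy \<open>\<phi>\<close> and shows that they are measurable in the initial
  state, which the definition through trajectory measures does not reveal.
\<close>

primrec stationary_value_iter :: "('x \<Rightarrow> 'a) \<Rightarrow> nat \<Rightarrow> 'x \<Rightarrow> ennreal" where
  "stationary_value_iter \<phi> 0 y = 0"
| "stationary_value_iter \<phi> (Suc n) y = qval (stationary_value_iter \<phi> n) (y, \<phi> y)"

lemma measurable_stationary_value_iter:
  assumes \<phi>: "selector M \<phi>"
  shows "stationary_value_iter \<phi> n \<in> borel_measurable (borel_on (states M))"
proof (induction n)
  case (Suc n)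
  have "(\<lambda>y. qval (stationary_value_iter \<phi> n) (y, \<phi> y)) \<in> borel_measurable (borel_on (states M))"
    by (rule measurable_compose[OF selector_graph_measurable[OF \<phi>] measurable_qval[OF Suc]])
  then show ?case
    by (simp add: fun_eq_iff cong: measurable_cong)
qed (simp add: fun_eq_iff cong: measurable_cong)

lemma stationary_cost_fixed_point:
  assumes \<phi>: "selector M \<phi>" and x: "x \<in> states M"
  shows "(SUP N. policy_ncost N (stationary M \<phi>) x) =
    qval (\<lambda>y. SUP N. policy_ncost N (stationary M \<phi>) y) (x, \<phi> x)"
proof -
  let ?w = "stationary_value_iter \<phi>"
  have w: "policy_ncost N (stationary M \<phi>) y = ?w N y" if y: "y \<in> states M" for N y
  proof -
    have "?w (N - 0) y = policy_ncost N (stationary M \<phi>) y +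
        ennreal (\<alpha> ^ N) * (\<integral>\<^sup>+\<omega>. ?w (N - N) (fst (\<omega> N)) \<partial>traj_measure M (stationary M \<phi>) y)"
    proof (rule telescope_markov[where w="\<lambda>n. ?w (N - n)" and N=N])
      fix n y assume "n < N" "y \<in> states M"
      then show "?w (N - n) y = qval (?w (N - Suc n)) (y, \<phi> y)"
        using stationary_value_iter.simps(2)[of \<phi> "N - Suc n" y] by (simp only: Suc_diff_Suc)
    qed (use \<phi> y measurable_stationary_value_iter in auto)
    then show ?thesis by simp
  qed
  have mono: "?w n y \<le> ?w (Suc n) y" if "y \<in> states M" for n y
    unfolding w[OF that, symmetric] by (rule policy_ncost_mono) simp
  have z: "(x, \<phi> x) \<in> Gr M"
    by (intro GrI x selector_avail[OF \<phi>])
  have "qval (\<lambda>y. SUP N. policy_ncost N (stationary M \<phi>) y) (x, \<phi> x) = qval (\<lambda>y. SUP N. ?w N y) (x, \<phi> x)"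
    by (rule qval_cong[OF z]) (simp add: w)
  also have "\<dots> = (SUP N. qval (?w N) (x, \<phi> x))"
    by (rule qval_SUP[where w="?w", OF z measurable_stationary_value_iter[OF \<phi>] mono])
  also have "\<dots> = (SUP N. ?w (Suc N) x)"
    by simp
  also have "\<dots> = (SUP N. ?w N x)"
    by (rule SUP_eq) (use mono[OF x] in blast)+
  also have "\<dots> = (SUP N. policy_ncost N (stationary M \<phi>) x)"
    by (simp add: w[OF x])
  finally show ?thesis by simp
qed

text \<open>
  The Bellman expression of a shifted function is shifted by \<open>L + \<alpha> * s\<close>, which is the recursion
  of \<open>shift\<close> and the fixed-point equation of \<open>shift_lim\<close>.
\<close>

lemma bellman_eq:
  assumes z: "x \<in> states M" "a \<in> avail M x" and w: "w \<in> borel_measurable (borel_on (states M))"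
    and v: "\<And>y. y \<in> states M \<Longrightarrow> v y = enn2ereal (w y) + ereal s"
  shows "bellman M \<alpha> v x a = enn2ereal (qval w (x, a)) + ereal (L + \<alpha> * s)"
proof -
  note z = GrI[OF z]
  have "eintegral (kernel M (x, a)) v = enn2ereal (\<integral>\<^sup>+y. w y \<partial>kernel M (x, a)) + ereal s"
  proof (rule eintegral_shifted[OF prob_space_kernel[OF z]])
    show "w \<in> borel_measurable (kernel M (x, a))"
      using w by (simp add: measurable_cong_sets[OF sets_kernel[OF z] refl])
    show "AE y in kernel M (x, a). v y = enn2ereal (w y) + ereal s"
      by (rule AE_I2) (simp add: space_kernel[OF z] v)
  qed
  then have "bellman M \<alpha> v x a = (enn2ereal (ncost (x, a)) + ereal L) +
      (enn2ereal (ennreal \<alpha> * (\<integral>\<^sup>+y. w y \<partial>kernel M (x, a))) + ereal (\<alpha> * s))"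
    by (simp add: bellman_def cost_eq[OF z] ereal_mult_shifted[OF alpha_nonneg])
  also have "\<dots> = enn2ereal (qval w (x, a)) + ereal (L + \<alpha> * s)"
    by (simp add: qval_def enn2ereal_add ac_simps flip: plus_ereal.simps(1))
  finally show ?thesis .
qed

end

section \<open>Structure of the value functions and of the optimal actions\<close>

context discounted_mdp
begin

lemma lower_semicont_shifted:
  assumes w: "seq_lsc (states M) w" and v: "\<And>y. y \<in> states M \<Longrightarrow> v y = enn2ereal (w y) + ereal s"
  shows "lower_semicont_on (states M) v"
  unfolding lower_semicont_on_def
proof
  fix r
  have "\<exists>C. closed C \<and> {y \<in> states M. v y \<le> ereal r} = states M \<inter> C"
  proof (intro exI conjI)
    let ?C = "closure {y \<in> states M. v y \<le> ereal r}"
    show "closed ?C" by simp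
    show "{y \<in> states M. v y \<le> ereal r} = states M \<inter> ?C"
    proof (intro equalityI subsetI IntI)
      fix l assume "l \<in> states M \<inter> ?C"
      then obtain z where l: "l \<in> states M" and z: "\<And>k. z k \<in> {y \<in> states M. v y \<le> ereal r}" "z \<longlonglongrightarrow> l"
        by (auto simp: closure_sequential)
      then have S: "z k \<in> states M" and "v (z k) \<le> ereal r" for k
        by auto
      then have s: "s \<le> r" and le: "w (z k) \<le> ennreal (r - s)" for k
        by (simp_all add: v shifted_le_ereal_iff)
      have "w l \<le> ennreal (r - s)"
        by (rule seq_lsc_level[OF w S l z(2) le])
      with l s show "l \<in> {y \<in> states M. v y \<le> ereal r}"
        by (simp add: v shifted_le_ereal_iff)
    qed (use closure_subset[of "{y \<in> states M. v y \<le> ereal r}"] in auto)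
  qed
  then show "closedin (top_of_set (states M)) {y \<in> states M. v y \<le> ereal r}"
    by (auto simp: closedin_closed)
qed

text \<open>
  The level set of \<open>v\<close> is relatively closed and lies in the projection of a level set of the
  cost, which is a compact subset of the state space.
\<close>

lemma inf_compact_shifted:
  assumes Wu: "assumption_Wu M" and lsc: "lower_semicont_on (states M) v"
    and v: "\<And>y. y \<in> states M \<Longrightarrow> v y = enn2ereal (w y) + ereal s"
    and att: "\<And>y. y \<in> states M \<Longrightarrow> \<exists>a\<in>avail M y. ncost (y, a) \<le> w y"
  shows "inf_compact_on (states M) v"
  unfolding inf_compact_on_def
proof
  fix r
  let ?K = "fst ` {z \<in> Gr M. cost M z \<le> ereal (r - s + L)}"
  have "compact ?K"
    using Wu by (intro compact_continuous_image continuous_on_fst continuous_on_id)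
      (simp add: assumption_Wu_def inf_compact_on_def)
  moreover have "{y \<in> states M. v y \<le> ereal r} \<subseteq> ?K"
  proof clarify
    fix y assume y: "y \<in> states M" "v y \<le> ereal r"
    obtain a where a: "a \<in> avail M y" "ncost (y, a) \<le> w y"
      using att[OF y(1)] by blast
    have "cost M (y, a) \<le> ereal (r - s + L)"
      using y(2) order_trans[OF a(2)] by (simp add: v[OF y(1)] cost_eq[OF GrI[OF y(1) a(1)]] shifted_le_ereal_iff)
    then show "y \<in> ?K"
      using GrI[OF y(1) a(1)] by (intro image_eqI[of _ _ "(y, a)"]) auto
  qed
  moreover have "?K \<subseteq> states M"
    by (auto simp: Gr_def)
  moreover obtain C where "closed C" "{y \<in> states M. v y \<le> ereal r} = states M \<inter> C"
    using lsc by (auto simp: lower_semicont_on_def closedin_closed)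
  ultimately have "{y \<in> states M. v y \<le> ereal r} = ?K \<inter> C" "closed C"
    by blast+
  with \<open>compact ?K\<close> show "compact {y \<in> states M. v y \<le> ereal r}"
    by (simp add: compact_Int_closed)
qed

lemma argmin_graph_borel:
  assumes w: "seq_lsc (states M) w" and v: "v \<in> borel_measurable (borel_on (states M))"
  shows "(SIGMA x:states M. {a \<in> avail M x. qval w (x, a) = v x}) \<in> sets borel"
proof -
  have Gr: "Gr M \<in> sets borel"
    using mdp by (simp add: is_mdp_def)
  have "fst \<in> borel_on (Gr M) \<rightarrow>\<^sub>M borel"
    by (intro borel_measurable_continuous_on_restrict continuous_on_fst continuous_on_id)
  then have "fst \<in> borel_on (Gr M) \<rightarrow>\<^sub>M borel_on (states M)"
    by (rule measurable_restrict_space2[rotated]) (auto simp: space_restrict_space Gr_def)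
  note [measurable] = measurable_compose[OF this v] borel_measurable_seq_lsc[OF seq_lsc_qval[OF w]]
  have "{z \<in> space (borel_on (Gr M)). qval w z = v (fst z)} \<in> sets (borel_on (Gr M))"
    by measurable
  then have "{z \<in> Gr M. qval w z = v (fst z)} \<in> sets borel"
    using Gr by (simp add: space_restrict_space sets_restrict_space_iff)
  also have "{z \<in> Gr M. qval w z = v (fst z)} = (SIGMA x:states M. {a \<in> avail M x. qval w (x, a) = v x})"
    by (auto simp: Gr_def)
  finally show ?thesis .
qed

lemma compact_argmin_qval:
  assumes w: "seq_lsc (states M) w" and x: "x \<in> states M"
    and v: "v x = (INF a\<in>avail M x. qval w (x, a))" "v x < top"
  shows "compact {a \<in> avail M x. qval w (x, a) = v x}"
  unfolding v(1)
  by (rule compact_argmin[OF _ inf_compact_qval x])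
     (use seq_lsc_qval[OF w] v in \<open>simp_all add: Gr_def\<close>)

lemma argmin_infinite:
  assumes v: "v x = (INF a\<in>avail M x. qval w (x, a))" "v x = top"
  shows "{a \<in> avail M x. qval w (x, a) = v x} = avail M x"
proof -
  have "top \<le> qval w (x, a)" if "a \<in> avail M x" for a
    using INF_lower[OF that, of "\<lambda>a. qval w (x, a)"] v by simp
  then show ?thesis
    using v(2) by (auto simp: top_unique)
qed

lemma bellman_value_fin:
  assumes "x \<in> states M" "a \<in> avail M x"
  shows "bellman M \<alpha> (value_fin M \<alpha> n) x a = enn2ereal (qval (value_iter n) (x, a)) + ereal (shift (Suc n))"
  unfolding shift_Suc by (rule bellman_eq[OF assms measurable_value_iter value_fin_eq])

lemma bellman_value_inf:
  assumes "x \<in> states M" "a \<in> avail M x"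
  shows "bellman M \<alpha> (value_inf M \<alpha>) x a = enn2ereal (qval value_lim (x, a)) + ereal shift_lim"
  by (subst shift_lim_eq) (rule bellman_eq[OF assms measurable_value_lim value_inf_eq])

lemma opt_actions_fin_eq:
  assumes "x \<in> states M"
  shows "opt_actions_fin M \<alpha> n x = {a \<in> avail M x. qval (value_iter n) (x, a) = value_iter (Suc n) x}"
  using assms
  by (auto simp: opt_actions_fin_def value_fin_eq bellman_value_fin shifted_eq_iff simp del: value_iter.simps)

lemma opt_actions_eq:
  assumes "x \<in> states M"
  shows "opt_actions M \<alpha> x = {a \<in> avail M x. qval value_lim (x, a) = value_lim x}"
  using assms by (auto simp: opt_actions_def value_inf_eq bellman_value_inf shifted_eq_iff)

lemma value_fin_is_minimum:
  assumes x: "x \<in> states M"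
  shows "is_minimum (value_fin M \<alpha> (Suc n) x) {bellman M \<alpha> (value_fin M \<alpha> n) x a | a. a \<in> avail M x}"
proof -
  obtain a where a: "a \<in> avail M x" "qval (value_iter n) (x, a) = value_iter (Suc n) x"
    using value_iter_attained[OF x] by blast
  have "value_iter (Suc n) x \<le> qval (value_iter n) (x, b)" if "b \<in> avail M x" for b
    using that by (auto intro: INF_lower)
  then show ?thesis
    using a x unfolding is_minimum_def
    by (auto simp: value_fin_eq bellman_value_fin shifted_le_iff shifted_eq_iff simp del: value_iter.simps)
       (metis bellman_value_fin)
qed

lemma value_inf_is_minimum:
  assumes x: "x \<in> states M"
  shows "is_minimum (value_inf M \<alpha> x) {bellman M \<alpha> (value_inf M \<alpha>) x a | a. a \<in> avail M x}"
proof -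
  obtain a where a: "a \<in> avail M x" "qval value_lim (x, a) = value_lim x"
    using value_lim_attained[OF x] by blast
  have "value_lim x \<le> qval value_lim (x, b)" if "b \<in> avail M x" for b
    using that unfolding bellman_value_lim[OF x] by (rule INF_lower)
  then show ?thesis
    using a x unfolding is_minimum_def
    by (auto simp: value_inf_eq bellman_value_inf shifted_le_iff shifted_eq_iff)
       (metis bellman_value_inf)
qed

lemma value_fin_tendsto:
  assumes x: "x \<in> states M"
  shows "(\<lambda>n. value_fin M \<alpha> n x) \<longlonglongrightarrow> value_inf M \<alpha> x"
  unfolding value_fin_eq[OF x] value_inf_eq[OF x]
  by (intro tendsto_shifted shift_tendsto) (simp add: value_lim_def LIMSEQ_SUP incseq_value_iter[OF x])

lemma incseq_value_fin_normalized:
  assumes x: "x \<in> states M"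
  shows "incseq (\<lambda>n. value_fin M \<alpha> n x - ereal (L * (\<Sum>k<n. \<alpha> ^ k)))"
proof (rule incseq_SucI)
  have "value_fin M \<alpha> n x - ereal (L * (\<Sum>k<n. \<alpha> ^ k)) = enn2ereal (value_iter n x)" for n
    unfolding value_fin_eq[OF x] shift_def[symmetric] by (cases "value_iter n x") auto
  then show "value_fin M \<alpha> n x - ereal (L * (\<Sum>k<n. \<alpha> ^ k)) \<le>
      value_fin M \<alpha> (Suc n) x - ereal (L * (\<Sum>k<Suc n. \<alpha> ^ k))" for n
    using value_iter_mono_Suc[OF x, of n] by (simp only: less_eq_ennreal.rep_eq)
qed

lemma horizon_optimalI:
  assumes \<phi>: "\<And>n. selector M (\<phi> n)"
    and greedy: "\<And>n y. n < N \<Longrightarrow> y \<in> states M \<Longrightarrow> \<phi> (N - 1 - n) y \<in> opt_actions_fin M \<alpha> n y"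
  shows "horizon_optimal M \<alpha> N (markov M \<phi>)"
proof -
  have pol: "is_policy M (markov M \<phi>)"
    by (rule is_policy_markov[OF mdp \<phi>])
  have g: "qval (value_iter n) (y, \<phi> (N - 1 - n) y) = value_iter (Suc n) y" if "n < N" "y \<in> states M" for n y
    using greedy[OF that] opt_actions_fin_eq[OF that(2)] by blast
  show ?thesis
    unfolding horizon_optimal_def
  proof (intro conjI ballI pol)
    fix x assume x: "x \<in> states M"
    show "policy_cost_fin M \<alpha> N (markov M \<phi>) x = value_fin M \<alpha> N x"
      by (simp only: policy_cost_fin_eq[OF pol x] greedy_horizon[OF \<phi> x g] value_fin_eq[OF x])
  qed
qed

lemma horizon_optimal_exists: "\<exists>\<phi>. (\<forall>n. selector M (\<phi> n)) \<and> horizon_optimal M \<alpha> N (markov M \<phi>)"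
proof -
  obtain \<phi> where \<phi>: "\<And>n. selector M (\<phi> n)"
    "\<And>n y. n < N \<Longrightarrow> y \<in> states M \<Longrightarrow> qval (value_iter n) (y, \<phi> (N - 1 - n) y) = value_iter (Suc n) y"
    using greedy_markov_exists[of N] by (auto simp del: value_iter.simps)
  then have "horizon_optimal M \<alpha> N (markov M \<phi>)"
    by (intro horizon_optimalI) (simp_all add: opt_actions_fin_eq selector_avail del: value_iter.simps)
  with \<phi>(1) show ?thesis by blast
qed

text \<open>
  If \<open>\<phi>\<close> is optimal, its cost is \<open>value_lim\<close> at every initial state, and the fixed-point
  equation of its cost says that \<open>\<phi>\<close> picks minimizers.
\<close>

lemma stationary_optimal_iff:
  assumes \<phi>: "selector M \<phi>"
  shows "discount_optimal M \<alpha> (stationary M \<phi>) \<longleftrightarrow> (\<forall>x\<in>states M. \<phi> x \<in> opt_actions M \<alpha> x)"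
proof
  note pol = is_policy_stationary[OF \<phi>]
  assume "discount_optimal M \<alpha> (stationary M \<phi>)"
  then have *: "(SUP N. policy_ncost N (stationary M \<phi>) y) = value_lim y" if "y \<in> states M" for y
    using that by (simp add: discount_optimal_def policy_cost_eq[OF pol] value_inf_eq shifted_eq_iff)
  show "\<forall>x\<in>states M. \<phi> x \<in> opt_actions M \<alpha> x"
  proof
    fix x assume x: "x \<in> states M"
    have "value_lim x = qval (\<lambda>y. SUP N. policy_ncost N (stationary M \<phi>) y) (x, \<phi> x)"
      using stationary_cost_fixed_point[OF \<phi> x] *[OF x] by simp
    also have "\<dots> = qval value_lim (x, \<phi> x)"
      by (rule qval_cong[OF GrI[OF x selector_avail[OF \<phi> x]] *])
    finally show "\<phi> x \<in> opt_actions M \<alpha> x"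
      by (simp add: opt_actions_eq[OF x] selector_avail[OF \<phi> x])
  qed
next
  assume "\<forall>x\<in>states M. \<phi> x \<in> opt_actions M \<alpha> x"
  then have "qval value_lim (y, \<phi> y) = value_lim y" if "y \<in> states M" for y
    using opt_actions_eq[OF that] that by blast
  then show "discount_optimal M \<alpha> (stationary M \<phi>)"
    using is_policy_stationary[OF \<phi>]
    by (simp add: discount_optimal_def greedy_stationary_cost[OF \<phi>] value_inf_eq)
qed

lemma discount_optimal_exists: "\<exists>\<phi>. selector M \<phi> \<and> discount_optimal M \<alpha> (stationary M \<phi>)"
proof -
  obtain \<phi> where \<phi>: "selector M \<phi>" "\<And>y. y \<in> states M \<Longrightarrow> qval value_lim (y, \<phi> y) = value_lim y"
    using greedy_stationary_exists by auto
  then have "discount_optimal M \<alpha> (stationary M \<phi>)"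
    by (simp add: stationary_optimal_iff opt_actions_eq selector_avail)
  with \<phi>(1) show ?thesis by blast
qed

lemma lower_semicont_value_fin: "lower_semicont_on (states M) (value_fin M \<alpha> n)"
  by (rule lower_semicont_shifted[OF seq_lsc_value_iter value_fin_eq])

lemma lower_semicont_value_inf: "lower_semicont_on (states M) (value_inf M \<alpha>)"
  by (rule lower_semicont_shifted[OF seq_lsc_value_lim value_inf_eq])

lemma inf_compact_value_fin:
  assumes "assumption_Wu M" "1 \<le> n" shows "inf_compact_on (states M) (value_fin M \<alpha> n)"
proof (rule inf_compact_shifted[OF assms(1) lower_semicont_value_fin value_fin_eq])
  fix y assume y: "y \<in> states M"
  obtain m where m: "n = Suc m"
    using assms(2) by (cases n) auto
  show "\<exists>a\<in>avail M y. ncost (y, a) \<le> value_iter n y"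
    using value_iter_attained[OF y, of m] ncost_le_qval unfolding m by metis
qed

lemma inf_compact_value_inf:
  assumes "assumption_Wu M" shows "inf_compact_on (states M) (value_inf M \<alpha>)"
proof (rule inf_compact_shifted[OF assms lower_semicont_value_inf value_inf_eq])
  fix y assume y: "y \<in> states M"
  show "\<exists>a\<in>avail M y. ncost (y, a) \<le> value_lim y"
    using value_lim_attained[OF y] ncost_le_qval by metis
qed

lemma opt_actions_fin_structure:
  assumes x: "x \<in> states M"
  shows "opt_actions_fin M \<alpha> n x \<noteq> {}"
    and "value_fin M \<alpha> (Suc n) x = \<infinity> \<Longrightarrow> opt_actions_fin M \<alpha> n x = avail M x"
    and "value_fin M \<alpha> (Suc n) x < \<infinity> \<Longrightarrow> compact (opt_actions_fin M \<alpha> n x)"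
proof -
  show "opt_actions_fin M \<alpha> n x \<noteq> {}"
    using value_iter_attained[OF x, of n] unfolding opt_actions_fin_eq[OF x] by blast
  show "opt_actions_fin M \<alpha> n x = avail M x" if "value_fin M \<alpha> (Suc n) x = \<infinity>"
    unfolding opt_actions_fin_eq[OF x]
    by (rule argmin_infinite[where v="value_iter (Suc n)"]) (use that in \<open>simp_all only: value_iter.simps(2) value_fin_eq[OF x] shifted_eq_infinity_iff\<close>)
  show "compact (opt_actions_fin M \<alpha> n x)" if "value_fin M \<alpha> (Suc n) x < \<infinity>"
  proof -
    have "value_iter (Suc n) x < top"
      using that shifted_eq_infinity_iff[of "value_iter (Suc n) x" "shift (Suc n)"]
      unfolding value_fin_eq[OF x] by (metis less_irrefl top.not_eq_extremum)
    then show ?thesis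
      unfolding opt_actions_fin_eq[OF x] by (intro compact_argmin_qval seq_lsc_value_iter x value_iter.simps(2))
  qed
qed

lemma opt_actions_structure:
  assumes x: "x \<in> states M"
  shows "opt_actions M \<alpha> x \<noteq> {}"
    and "value_inf M \<alpha> x = \<infinity> \<Longrightarrow> opt_actions M \<alpha> x = avail M x"
    and "value_inf M \<alpha> x < \<infinity> \<Longrightarrow> compact (opt_actions M \<alpha> x)"
proof -
  show "opt_actions M \<alpha> x \<noteq> {}"
    using value_lim_attained[OF x] unfolding opt_actions_eq[OF x] by blast
  show "opt_actions M \<alpha> x = avail M x" if "value_inf M \<alpha> x = \<infinity>"
    unfolding opt_actions_eq[OF x]
    by (rule argmin_infinite[where v=value_lim, OF bellman_value_lim[OF x]])
       (use that in \<open>simp only: value_inf_eq[OF x] shifted_eq_infinity_iff\<close>)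
  show "compact (opt_actions M \<alpha> x)" if "value_inf M \<alpha> x < \<infinity>"
  proof -
    have "value_lim x < top"
      using that shifted_eq_infinity_iff[of "value_lim x" shift_lim]
      unfolding value_inf_eq[OF x] by (metis less_irrefl top.not_eq_extremum)
    then show ?thesis
      unfolding opt_actions_eq[OF x] by (intro compact_argmin_qval seq_lsc_value_lim x bellman_value_lim)
  qed
qed

lemma graph_opt_actions_fin_borel: "(SIGMA x:states M. opt_actions_fin M \<alpha> n x) \<in> sets borel"
  using argmin_graph_borel[OF seq_lsc_value_iter[of n] measurable_value_iter[of "Suc n"]]
  by (simp add: opt_actions_fin_eq del: value_iter.simps cong: Sigma_cong)

lemma graph_opt_actions_borel: "(SIGMA x:states M. opt_actions M \<alpha> x) \<in> sets borel"
  using argmin_graph_borel[OF seq_lsc_value_lim measurable_value_lim]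
  by (simp add: opt_actions_eq cong: Sigma_cong)

end

theorem theorem4p1:
  fixes M :: "('x::polish_space, 'a::polish_space) mdp" and \<alpha> :: real
  assumes mdp: "is_mdp M"
    and Wstar: "assumption_Wstar M"
    and alpha: "0 \<le> \<alpha>" "\<alpha> < 1"
  shows
    "\<comment> \<open>(i)\<close>
     (\<forall>n\<ge>1. lower_semicont_on (states M) (value_fin M \<alpha> n)) \<and>
     lower_semicont_on (states M) (value_inf M \<alpha>) \<and>
     (\<forall>x\<in>states M. (\<lambda>n. value_fin M \<alpha> n x) \<longlonglongrightarrow> value_inf M \<alpha> x) \<and>
     ((\<forall>z\<in>Gr M. 0 \<le> cost M z) \<longrightarrow>
        (\<forall>x\<in>states M. incseq (\<lambda>n. value_fin M \<alpha> n x))) \<and>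
     \<comment> \<open>literal monotonicity fails for negative costs; in general it holds after normalizing
        by a lower bound \<open>L\<close> of the cost\<close>
     (\<forall>L::real. (\<forall>z\<in>Gr M. ereal L \<le> cost M z) \<longrightarrow>
        (\<forall>x\<in>states M. incseq (\<lambda>n. value_fin M \<alpha> n x - ereal (L * (\<Sum>k<n. \<alpha> ^ k))))) \<and>
     \<comment> \<open>(ii)\<close>
     (\<forall>x\<in>states M. value_fin M \<alpha> 0 x = 0) \<and>
     (\<forall>n. \<forall>x\<in>states M.
        is_minimum (value_fin M \<alpha> (Suc n) x)
          {bellman M \<alpha> (value_fin M \<alpha> n) x a | a. a \<in> avail M x}) \<and>
     (\<forall>n. \<forall>x\<in>states M. opt_actions_fin M \<alpha> n x \<noteq> {}) \<and>
     (\<forall>n. (SIGMA x:states M. opt_actions_fin M \<alpha> n x) \<in> sets borel) \<and>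
     (\<forall>n. \<forall>x\<in>states M.
        (value_fin M \<alpha> (Suc n) x = \<infinity> \<longrightarrow> opt_actions_fin M \<alpha> n x = avail M x) \<and>
        (value_fin M \<alpha> (Suc n) x < \<infinity> \<longrightarrow> compact (opt_actions_fin M \<alpha> n x))) \<and>
     \<comment> \<open>(iii)\<close>
     (\<forall>N\<ge>1.
        (\<exists>\<phi>. (\<forall>n. selector M (\<phi> n)) \<and> horizon_optimal M \<alpha> N (markov M \<phi>)) \<and>
        (\<forall>\<phi>. (\<forall>n. selector M (\<phi> n)) \<and>
              (\<forall>n<N. \<forall>x\<in>states M. \<phi> (N - 1 - n) x \<in> opt_actions_fin M \<alpha> n x) \<longrightarrow>
              horizon_optimal M \<alpha> N (markov M \<phi>))) \<and>
     \<comment> \<open>(iv)\<close>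
     (\<forall>x\<in>states M.
        is_minimum (value_inf M \<alpha> x)
          {bellman M \<alpha> (value_inf M \<alpha>) x a | a. a \<in> avail M x}) \<and>
     (\<forall>x\<in>states M. opt_actions M \<alpha> x \<noteq> {}) \<and>
     (SIGMA x:states M. opt_actions M \<alpha> x) \<in> sets borel \<and>
     (\<forall>x\<in>states M.
        (value_inf M \<alpha> x = \<infinity> \<longrightarrow> opt_actions M \<alpha> x = avail M x) \<and>
        (value_inf M \<alpha> x < \<infinity> \<longrightarrow> compact (opt_actions M \<alpha> x))) \<and>
     \<comment> \<open>(v)\<close>
     (\<exists>\<phi>. selector M \<phi> \<and> discount_optimal M \<alpha> (stationary M \<phi>)) \<and>
     (\<forall>\<phi>. selector M \<phi> \<longrightarrow>
        (discount_optimal M \<alpha> (stationary M \<phi>) \<longleftrightarrow>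
         (\<forall>x\<in>states M. \<phi> x \<in> opt_actions M \<alpha> x))) \<and>
     \<comment> \<open>(vi)\<close>
     (assumption_Wu M \<longrightarrow>
        (\<forall>n\<ge>1. inf_compact_on (states M) (value_fin M \<alpha> n)) \<and>
        inf_compact_on (states M) (value_inf M \<alpha>))"
proof -
  have dm: "discounted_mdp M \<alpha> L'" if "\<forall>z\<in>Gr M. ereal L' \<le> cost M z" for L'
    using mdp Wstar alpha that by (unfold_locales) auto
  obtain L where L: "\<forall>z\<in>Gr M. ereal L \<le> cost M z"
    using mdp by (auto simp: is_mdp_def)
  interpret discounted_mdp M \<alpha> L
    by (rule dm[OF L])
  \<comment> \<open>Each lower bound has its own normalized value iteration, and monotonicity for that bound is
    monotonicity of that iteration.\<close>
  have norm: "incseq (\<lambda>n. value_fin M \<alpha> n x - ereal (L' * (\<Sum>k<n. \<alpha> ^ k)))"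
    if "\<forall>z\<in>Gr M. ereal L' \<le> cost M z" "x \<in> states M" for L' x
    by (rule discounted_mdp.incseq_value_fin_normalized[OF dm[OF that(1)] that(2)])
  have nonneg: "incseq (\<lambda>n. value_fin M \<alpha> n x)" if "\<forall>z\<in>Gr M. 0 \<le> cost M z" "x \<in> states M" for x
    using norm[of 0 x] that by (simp flip: zero_ereal_def)
  have zero: "value_fin M \<alpha> 0 x = 0" if "x \<in> states M" for x
    by (simp add: value_fin_eq[OF that] shift_def zero_ennreal.rep_eq flip: zero_ereal_def)
  have greedy: "horizon_optimal M \<alpha> N (markov M \<phi>)"
    if "(\<forall>n. selector M (\<phi> n)) \<and> (\<forall>n<N. \<forall>x\<in>states M. \<phi> (N - 1 - n) x \<in> opt_actions_fin M \<alpha> n x)" for \<phi> N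
    using that by (intro horizon_optimalI) blast+
  show ?thesis
    by (intro conjI allI ballI impI;
        (assumption | rule lower_semicont_value_fin lower_semicont_value_inf
        value_fin_tendsto nonneg norm zero value_fin_is_minimum opt_actions_fin_structure graph_opt_actions_fin_borel
        horizon_optimal_exists greedy value_inf_is_minimum opt_actions_structure graph_opt_actions_borel
        discount_optimal_exists stationary_optimal_iff inf_compact_value_fin inf_compact_value_inf)+)
qed

end
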